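(* An $\mathcal L_e$-structure $M$ is $\mathrm H$-extensional and satisfies $\mathcal L_e$-excision if and only if it satisfies the following \L ukasiewicz-logic sentences: $$\forall x\forall y\bigl(x\mathrel{\hat\epsilon}y\leftrightarrow\exists z(x=_e z\mathbin{\&}z\mathrel{\hat\epsilon}y\mathbin{\&}z\mathrel{\hat\epsilon}y)\bigr)\qquad(1)$$ and, for every \L ukasiewicz formula $\varphi(x,\bar y)$ not containing $z$ as a free variable, $$\forall\bar y\,\exists z\,\forall x\ \bigl(x\mathrel{\hat\epsilon}z\vee(\neg\varphi\oplus\neg\varphi\oplus\neg\varphi)\bigr)\wedge\bigl((\underbrace{\neg x\mathrel{\hat\epsilon}z\oplus\cdots\oplus\neg x\mathrel{\hat\epsilon}z}_{6\cdot\#\varphi\text{ times}})\vee(\varphi\oplus\varphi\oplus\varphi)\bigr).\qquad(2_\varphi)$$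
   Context: An $\mathcal L_e$-structure is a nonempty set $M$ with a function $e:M^2\to[0,1]$. Put $d_e(x,y)=\sup_{z\in M}|e(z,x)-e(z,y)|$. $M$ is $\mathrm H$-extensional if $e(x,y)=\inf_{z}\min(d_e(x,z)+2e(z,y),1)$ for all $x,y\in M$. Restricted $\mathcal L_e$-formulas are built from atomic formulas $e(x,y)$ and the constant $1$ using $\varphi+\psi$, $\max$, $\min$, $r\cdot\varphi$ ($r\in\mathbb Q$), $\sup_x$, $\inf_x$. Put $v(1)=v(e(x,y))=1$, $v(\varphi+\psi)=v(\varphi)+v(\psi)$, $v(\max(\varphi,\psi))=v(\min(\varphi,\psi))=\max(v(\varphi),v(\psi))$, $v(r\varphi)=|r|v(\varphi)$, quantifiers do not change $v$, and $\varepsilon_\varphi=\dfrac1{\max(6v(\varphi),3)}$. $M$ satisfies $\mathcal L_e$-excision if for each restricted $\mathcal L_e$-formula $\varphi(x,\bar y)$ (not containing $z$ free), $$\sup_{\bar y}\inf_z\sup_x\max\bigl(\min(e(x,z),-\varphi(x,\bar y)),\ \min(\varepsilon_\varphi-e(x,z),\varphi(x,\bar y)-1)\bigr)\le 0$$ holds in $M$. \L ukasiewicz formulas (truth values in $[0,1]$, with $1$ meaning true) are built from atomic formulas $x\mathrel{\hat\epsilon}y$, interpreted as $1-e(x,y)$, using $\bot$ (value $0$), $A\to B$ (value $\min(1-A+B,1)$), $\exists x$ (interpreted as $\sup_x$) and $\forall x$ (interpreted as $\inf_x$). Derived connectives: $A\leftrightarrow B$ has value $1-|A-B|$, $\neg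 A$ has value $1-A$, $A\wedge B$ is $\min(A,B)$, $A\vee B$ is $\max(A,B)$, $A\mathbin{\&}B$ is $\max(A+B-1,0)$, and $A\oplus B$ is $\min(A+B,1)$. $x=_e y$ abbreviates $\forall z(z\mathrel{\hat\epsilon}x\leftrightarrow z\mathrel{\hat\epsilon}y)$ (value $1-d_e(x,y)$). $\#\varphi$ is the number of occurrences of $\hat\epsilon$ in $\varphi$; when $\#\varphi=0$, the $0$-fold expression in $(2_\varphi)$ is read as the constant $1$. $M$ satisfies a \L ukasiewicz sentence if its value in $M$ is $1$. *)

theory Defs
  imports Complex_Main
begin

section \<open>Structures\<close>

definition Le_structure :: "'a set \<Rightarrow> ('a \<Rightarrow> 'a \<Rightarrow> real) \<Rightarrow> bool" where
  "Le_structure M e \<longleftrightarrow> M \<noteq> {} \<and> (\<forall>x\<in>M. \<forall>y\<in>M. 0 \<le> e x y \<and> e x y \<le> 1)"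

definition d_e :: "'a set \<Rightarrow> ('a \<Rightarrow> 'a \<Rightarrow> real) \<Rightarrow> 'a \<Rightarrow> 'a \<Rightarrow> real" where
  "d_e M e x y = (SUP z\<in>M. \<bar>e z x - e z y\<bar>)"

definition H_extensional :: "'a set \<Rightarrow> ('a \<Rightarrow> 'a \<Rightarrow> real) \<Rightarrow> bool" where
  "H_extensional M e \<longleftrightarrow>
     (\<forall>x\<in>M. \<forall>y\<in>M. e x y = (INF z\<in>M. min (d_e M e x z + 2 * e z y) 1))"

text \<open>
  Formulas of both logics are given by their abstract syntax. Variables are natural numbers and
  binding is by name, so assignments have type \<open>nat \<Rightarrow> 'a\<close>; only assignments with all values
  in \<open>M\<close> are considered. The real suprema and infima below are then always taken over nonempty
  bounded sets.
\<close>

section \<open>Restricted formulas and excision\<close>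

datatype rform =
    RE nat nat
  | ROne
  | RAdd rform rform
  | RMax rform rform
  | RMin rform rform
  | RScale rat rform
  | RSup nat rform
  | RInf nat rform

primrec rval :: "'a set \<Rightarrow> ('a \<Rightarrow> 'a \<Rightarrow> real) \<Rightarrow> rform \<Rightarrow> (nat \<Rightarrow> 'a) \<Rightarrow> real" where
  "rval M e (RE x y) s = e (s x) (s y)"
| "rval M e ROne s = 1"
| "rval M e (RAdd p q) s = rval M e p s + rval M e q s"
| "rval M e (RMax p q) s = max (rval M e p s) (rval M e q s)"
| "rval M e (RMin p q) s = min (rval M e p s) (rval M e q s)"
| "rval M e (RScale r p) s = of_rat r * rval M e p s"
| "rval M e (RSup x p) s = (SUP a\<in>M. rval M e p (s(x := a)))"
| "rval M e (RInf x p) s = (INF a\<in>M. rval M e p (s(x := a)))"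

primrec rfv :: "rform \<Rightarrow> nat set" where
  "rfv (RE x y) = {x, y}"
| "rfv ROne = {}"
| "rfv (RAdd p q) = rfv p \<union> rfv q"
| "rfv (RMax p q) = rfv p \<union> rfv q"
| "rfv (RMin p q) = rfv p \<union> rfv q"
| "rfv (RScale r p) = rfv p"
| "rfv (RSup x p) = rfv p - {x}"
| "rfv (RInf x p) = rfv p - {x}"

primrec v_of :: "rform \<Rightarrow> rat" where
  "v_of (RE x y) = 1"
| "v_of ROne = 1"
| "v_of (RAdd p q) = v_of p + v_of q"
| "v_of (RMax p q) = max (v_of p) (v_of q)"
| "v_of (RMin p q) = max (v_of p) (v_of q)"
| "v_of (RScale r p) = \<bar>r\<bar> * v_of p"
| "v_of (RSup x p) = v_of p"
| "v_of (RInf x p) = v_of p"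

definition eps :: "rform \<Rightarrow> rat" where
  "eps p = 1 / max (6 * v_of p) 3"

definition excision_form :: "rform \<Rightarrow> nat \<Rightarrow> nat \<Rightarrow> nat list \<Rightarrow> rform" where
  "excision_form p x z ys =
     foldr RSup ys (RInf z (RSup x
       (RMax (RMin (RE x z) (RScale (-1) p))
             (RMin (RAdd (RScale (eps p) ROne) (RScale (-1) (RE x z)))
                   (RAdd p (RScale (-1) ROne))))))"

text \<open>
  Writing \<open>p(x, ys)\<close> means that the free variables of \<open>p\<close> are among \<open>x\<close> and \<open>ys\<close>, where
  \<open>x, z, ys\<close> are pairwise distinct; in particular \<open>z\<close> is not free in \<open>p\<close> (it may be bound in it).
\<close>

definition excision :: "'a set \<Rightarrow> ('a \<Rightarrow> 'a \<Rightarrow> real) \<Rightarrow> bool" where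
  "excision M e \<longleftrightarrow>
     (\<forall>p x z ys. distinct (x # z # ys) \<longrightarrow> rfv p \<subseteq> insert x (set ys) \<longrightarrow>
        (\<forall>s. range s \<subseteq> M \<longrightarrow> rval M e (excision_form p x z ys) s \<le> 0))"

section \<open>Lukasiewicz formulas\<close>

text \<open>\<open>LIn x y\<close> is the atomic formula with value \<open>1 - e x y\<close>.\<close>

datatype lform =
    LIn nat nat
  | LBot
  | LImp lform lform
  | LEx nat lform
  | LAll nat lform

primrec lval :: "'a set \<Rightarrow> ('a \<Rightarrow> 'a \<Rightarrow> real) \<Rightarrow> lform \<Rightarrow> (nat \<Rightarrow> 'a) \<Rightarrow> real" where
  "lval M e (LIn x y) s = 1 - e (s x) (s y)"
| "lval M e LBot s = 0"
| "lval M e (LImp A B) s = min (1 - lval M e A s + lval M e B s) 1"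
| "lval M e (LEx x A) s = (SUP a\<in>M. lval M e A (s(x := a)))"
| "lval M e (LAll x A) s = (INF a\<in>M. lval M e A (s(x := a)))"

primrec lfv :: "lform \<Rightarrow> nat set" where
  "lfv (LIn x y) = {x, y}"
| "lfv LBot = {}"
| "lfv (LImp A B) = lfv A \<union> lfv B"
| "lfv (LEx x A) = lfv A - {x}"
| "lfv (LAll x A) = lfv A - {x}"

primrec occ :: "lform \<Rightarrow> nat" where
  "occ (LIn x y) = 1"
| "occ LBot = 0"
| "occ (LImp A B) = occ A + occ B"
| "occ (LEx x A) = occ A"
| "occ (LAll x A) = occ A"

text \<open>The value of a sentence does not depend on the assignment (see \<open>lval_cong\<close> below).\<close>

definition lsat :: "'a set \<Rightarrow> ('a \<Rightarrow> 'a \<Rightarrow> real) \<Rightarrow> lform \<Rightarrow> bool" where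
  "lsat M e A \<longleftrightarrow> (\<forall>s. range s \<subseteq> M \<longrightarrow> lval M e A s = 1)"

text \<open>The derived connectives; their values are recorded in \<open>lval_derived\<close> below.\<close>

definition LTop :: lform where
  "LTop = LImp LBot LBot"

definition LNot :: "lform \<Rightarrow> lform" where
  "LNot A = LImp A LBot"

definition LOr :: "lform \<Rightarrow> lform \<Rightarrow> lform" where
  "LOr A B = LImp (LImp A B) B"

definition LAnd :: "lform \<Rightarrow> lform \<Rightarrow> lform" where
  "LAnd A B = LNot (LOr (LNot A) (LNot B))"

definition LIff :: "lform \<Rightarrow> lform \<Rightarrow> lform" where
  "LIff A B = LAnd (LImp A B) (LImp B A)"

definition LStrong :: "lform \<Rightarrow> lform \<Rightarrow> lform"  (infixr \<open>\<odot>l\<close> 65) where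
  "A \<odot>l B = LNot (LImp A (LNot B))"

definition LPlus :: "lform \<Rightarrow> lform \<Rightarrow> lform"  (infixr \<open>\<oplus>l\<close> 65) where
  "A \<oplus>l B = LImp (LNot A) B"

text \<open>The bound variable is chosen different from \<open>x\<close> and \<open>y\<close>.\<close>

definition LEq :: "nat \<Rightarrow> nat \<Rightarrow> lform" where
  "LEq x y = (let w = Suc (max x y) in LAll w (LIff (LIn w x) (LIn w y)))"

text \<open>By convention the \<open>0\<close>-fold sum is true, not false as the empty sum would suggest.\<close>

fun LMult :: "nat \<Rightarrow> lform \<Rightarrow> lform" where
  "LMult 0 A = LTop"
| "LMult (Suc 0) A = A"
| "LMult (Suc (Suc n)) A = A \<oplus>l LMult (Suc n) A"

definition H_ext_sentence :: lform where
  "H_ext_sentence =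
     (let x = 0; y = 1; z = 2 in
       LAll x (LAll y (LIff (LIn x y) (LEx z (LEq x z \<odot>l LIn z y \<odot>l LIn z y)))))"

definition excision_sentence :: "lform \<Rightarrow> nat \<Rightarrow> nat \<Rightarrow> nat list \<Rightarrow> lform" where
  "excision_sentence A x z ys =
     foldr LAll ys (LEx z (LAll x
       (LAnd (LOr (LIn x z) (LNot A \<oplus>l LNot A \<oplus>l LNot A))
             (LOr (LMult (6 * occ A) (LNot (LIn x z))) (A \<oplus>l A \<oplus>l A)))))"

section \<open>Sanity checks\<close>

lemma lval_bounds:
  assumes "Le_structure M e" "range s \<subseteq> M"
  shows "0 \<le> lval M e A s \<and> lval M e A s \<le> 1"
  using assms(2)
proof (induction A arbitrary: s)
  case (LIn x y)
  then have "s x \<in> M" "s y \<in> M" by auto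
  then show ?case using assms(1) by (simp add: Le_structure_def)
next
  case (LImp A B)
  then show ?case by force
next
  case (LEx x A)
  have ne: "M \<noteq> {}" using assms(1) by (simp add: Le_structure_def)
  have b: "0 \<le> lval M e A (s(x := a)) \<and> lval M e A (s(x := a)) \<le> 1" if "a \<in> M" for a
    using LEx that by (intro LEx.IH) auto
  then have "bdd_above ((\<lambda>a. lval M e A (s(x := a))) ` M)" by (intro bdd_aboveI2[of _ _ 1]) auto
  moreover obtain a where "a \<in> M" using ne by blast
  ultimately have "0 \<le> (SUP a\<in>M. lval M e A (s(x := a)))"
    using b by (intro cSUP_upper2[of _ _ a]) auto
  moreover have "(SUP a\<in>M. lval M e A (s(x := a))) \<le> 1"
    using ne b by (intro cSUP_least) auto
  ultimately show ?case by simp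
next
  case (LAll x A)
  have ne: "M \<noteq> {}" using assms(1) by (simp add: Le_structure_def)
  have b: "0 \<le> lval M e A (s(x := a)) \<and> lval M e A (s(x := a)) \<le> 1" if "a \<in> M" for a
    using LAll that by (intro LAll.IH) auto
  then have "bdd_below ((\<lambda>a. lval M e A (s(x := a))) ` M)" by (intro bdd_belowI2[of _ 0]) auto
  moreover obtain a where "a \<in> M" using ne by blast
  ultimately have "(INF a\<in>M. lval M e A (s(x := a))) \<le> 1"
    using b by (intro cINF_lower2[of _ _ a]) auto
  moreover have "0 \<le> (INF a\<in>M. lval M e A (s(x := a)))"
    using ne b by (intro cINF_greatest) auto
  ultimately show ?case by simp
qed simp

lemma lval_derived:
  assumes "Le_structure M e" "range s \<subseteq> M"
  shows "lval M e (LNot A) s = 1 - lval M e A s"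
    and "lval M e (LOr A B) s = max (lval M e A s) (lval M e B s)"
    and "lval M e (LAnd A B) s = min (lval M e A s) (lval M e B s)"
    and "lval M e (LIff A B) s = 1 - \<bar>lval M e A s - lval M e B s\<bar>"
    and "lval M e (A \<odot>l B) s = max (lval M e A s + lval M e B s - 1) 0"
    and "lval M e (A \<oplus>l B) s = min (lval M e A s + lval M e B s) 1"
    and "lval M e LTop s = 1"
proof -
  have LNot: "lval M e (LNot C) s = 1 - lval M e C s" for C
    using lval_bounds[OF assms, of C] by (simp add: LNot_def)
  have LOr: "lval M e (LOr C D) s = max (lval M e C s) (lval M e D s)" for C D
    using lval_bounds[OF assms, of C] lval_bounds[OF assms, of D] by (simp add: LOr_def)
  have LAnd: "lval M e (LAnd C D) s = min (lval M e C s) (lval M e D s)" for C D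
    unfolding LAnd_def LNot LOr by linarith
  show "lval M e (LNot A) s = 1 - lval M e A s" by (rule LNot)
  show "lval M e (LOr A B) s = max (lval M e A s) (lval M e B s)" by (rule LOr)
  show "lval M e (LAnd A B) s = min (lval M e A s) (lval M e B s)" by (rule LAnd)
  show "lval M e (LIff A B) s = 1 - \<bar>lval M e A s - lval M e B s\<bar>"
    unfolding LIff_def LAnd lval.simps by linarith
  show "lval M e (A \<odot>l B) s = max (lval M e A s + lval M e B s - 1) 0"
    unfolding LStrong_def LNot lval.simps by linarith
  show "lval M e (A \<oplus>l B) s = min (lval M e A s + lval M e B s) 1"
    unfolding LPlus_def LNot lval.simps by simp
  show "lval M e LTop s = 1" by (simp add: LTop_def)
qed

lemma lval_LEq:
  assumes "Le_structure M e" "range s \<subseteq> M"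
  shows "lval M e (LEq x y) s = 1 - d_e M e (s x) (s y)"
proof -
  let ?f = "\<lambda>a. \<bar>e a (s x) - e a (s y)\<bar>"
  have xy: "s x \<in> M" "s y \<in> M" using assms(2) by auto
  have ne: "M \<noteq> {}" using assms(1) by (simp add: Le_structure_def)
  have f1: "?f a \<le> 1" if "a \<in> M" for a
    using assms(1) that xy unfolding Le_structure_def by (smt (verit))
  have ba: "bdd_above (?f ` M)" using f1 by (rule bdd_aboveI2)
  have bb: "bdd_below ((\<lambda>a. 1 - ?f a) ` M)" using f1 by (intro bdd_belowI2[of _ 0]) auto
  have r: "range (s(w := a)) \<subseteq> M" if "a \<in> M" for a w using assms(2) that by auto
  have "lval M e (LEq x y) s = (INF a\<in>M. 1 - ?f a)"
    unfolding LEq_def Let_def lval.simps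
  proof (rule INF_cong[OF refl])
    fix a assume "a \<in> M"
    show "lval M e (LIff (LIn (Suc (max x y)) x) (LIn (Suc (max x y)) y)) (s(Suc (max x y) := a)) =
       1 - ?f a"
      by (subst lval_derived(4)[OF assms(1) r[OF \<open>a \<in> M\<close>]])
         (auto simp: max_def abs_minus_commute)
  qed
  also have "\<dots> = 1 - (SUP a\<in>M. ?f a)"
  proof (rule antisym)
    have "(SUP a\<in>M. ?f a) \<le> 1 - (INF a\<in>M. 1 - ?f a)"
    proof (rule cSUP_least[OF ne])
      fix a assume "a \<in> M"
      from cINF_lower[OF bb this] show "?f a \<le> 1 - (INF a\<in>M. 1 - ?f a)" by linarith
    qed
    then show "(INF a\<in>M. 1 - ?f a) \<le> 1 - (SUP a\<in>M. ?f a)" by linarith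
    show "1 - (SUP a\<in>M. ?f a) \<le> (INF a\<in>M. 1 - ?f a)"
    proof (rule cINF_greatest[OF ne])
      fix a assume "a \<in> M"
      from cSUP_upper[OF this ba] show "1 - (SUP a\<in>M. ?f a) \<le> 1 - ?f a" by linarith
    qed
  qed
  finally show ?thesis by (simp add: d_e_def)
qed

lemma lval_cong:
  "(\<And>n. n \<in> lfv A \<Longrightarrow> s n = t n) \<Longrightarrow> lval M e A s = lval M e A t"
proof (induction A arbitrary: s t)
  case (LImp A B)
  have "lval M e A s = lval M e A t" "lval M e B s = lval M e B t"
    using LImp.prems by (auto intro!: LImp.IH)
  then show ?case by simp
next
  case (LEx x A)
  have "lval M e A (s(x := a)) = lval M e A (t(x := a))" for a
    by (rule LEx.IH) (use LEx.prems in auto)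
  then show ?case by simp
next
  case (LAll x A)
  have "lval M e A (s(x := a)) = lval M e A (t(x := a))" for a
    by (rule LAll.IH) (use LAll.prems in auto)
  then show ?case by simp
qed simp_all

lemma rval_cong:
  "(\<And>n. n \<in> rfv p \<Longrightarrow> s n = t n) \<Longrightarrow> rval M e p s = rval M e p t"
proof (induction p arbitrary: s t)
  case (RAdd p q)
  have "rval M e p s = rval M e p t" "rval M e q s = rval M e q t"
    using RAdd.prems by (auto intro!: RAdd.IH)
  then show ?case by simp
next
  case (RMax p q)
  have "rval M e p s = rval M e p t" "rval M e q s = rval M e q t"
    using RMax.prems by (auto intro!: RMax.IH)
  then show ?case by simp
next
  case (RMin p q)
  have "rval M e p s = rval M e p t" "rval M e q s = rval M e q t"
    using RMin.prems by (auto intro!: RMin.IH)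
  then show ?case by simp
next
  case (RScale r p)
  have "rval M e p s = rval M e p t"
    using RScale.prems by (auto intro!: RScale.IH)
  then show ?case by simp
next
  case (RSup x p)
  have "rval M e p (s(x := a)) = rval M e p (t(x := a))" for a
    by (rule RSup.IH) (use RSup.prems in auto)
  then show ?case by simp
next
  case (RInf x p)
  have "rval M e p (s(x := a)) = rval M e p (t(x := a))" for a
    by (rule RInf.IH) (use RInf.prems in auto)
  then show ?case by simp
qed simp_all

lemma lfv_foldr: "lfv (foldr LAll ys A) = lfv A - set ys"
  by (induction ys) auto

lemma rfv_foldr: "rfv (foldr RSup ys p) = rfv p - set ys"
  by (induction ys) auto

lemma lfv_LMult: "lfv (LMult n A) \<subseteq> lfv A"
  by (induction n A rule: LMult.induct) (auto simp: LPlus_def LNot_def LTop_def)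

lemma closed_sentences:
  "lfv H_ext_sentence = {}"
  "lfv A \<subseteq> insert x (set ys) \<Longrightarrow> lfv (excision_sentence A x z ys) = {}"
  "rfv p \<subseteq> insert x (set ys) \<Longrightarrow> rfv (excision_form p x z ys) = {}"
proof -
  show "lfv H_ext_sentence = {}"
    by (auto simp: H_ext_sentence_def Let_def LEq_def LIff_def LAnd_def LOr_def LNot_def LStrong_def)
  show "lfv (excision_sentence A x z ys) = {}" if "lfv A \<subseteq> insert x (set ys)"
    using that lfv_LMult[of "6 * occ A" "LNot (LIn x z)"]
    unfolding excision_sentence_def lfv_foldr
    by (auto simp: LAnd_def LOr_def LNot_def LPlus_def)
  show "rfv (excision_form p x z ys) = {}" if "rfv p \<subseteq> insert x (set ys)"
    using that unfolding excision_form_def rfv_foldr by auto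
qed

end

theory Submission
  imports Defs
begin

text \<open>
  The extensionality sentence transcribes H-extensionality: the value of its right-hand side is one
  minus the infimum in the definition. The content lies in comparing the two excision schemes.
  Both of them say, up to an arbitrarily small error \<open>\<delta>\<close>, that there is a set \<open>c\<close> with \<open>e a c\<close>
  almost \<open>0\<close> when a given function of \<open>a\<close> is below one threshold and \<open>e a c\<close> bounded below by a
  prescribed constant when the function is above a second, larger threshold. The constants differ,
  and the two logics express different functions.

  The constants hardly matter, because in an H-extensional structure any positive lower bound
  improves itself (\<open>extensional_lower_bound\<close>). Suppose \<open>T\<close> is \<open>1\<close>-Lipschitz for \<open>d_e\<close>, at most
  \<open>1\<close>, and \<open>e a c \<ge> \<epsilon>\<close> wherever \<open>T a > 0\<close>. Since \<open>e a c\<close> is an infimum of terms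
  \<open>d_e a w + 2 * e w c\<close>, the defect \<open>T a - e a c\<close> is approximately, for some \<open>w\<close>,
  either nonpositive (if \<open>T w \<le> 0\<close>) or at most the defect at \<open>w\<close> minus a further \<open>e w c \<ge> \<epsilon>\<close>.
  So the supremum of the defects cannot be positive, and
  \<open>T a \<le> e a c\<close> however small \<open>\<epsilon>\<close> was. Formulas are Lipschitz (\<open>lval_lipschitz\<close>,
  \<open>rval_lipschitz\<close>) with constant twice \<open>occ\<close> or \<open>v_of\<close>; the factor two is due to atomic formulas
  \<open>e(x,x)\<close>. Hence it suffices to apply a scheme with two very close thresholds, at the price of a
  tiny constant, and to recover the required constant from the distance to the second threshold.

  A Lukasiewicz formula \<open>A\<close> is also a restricted formula, so excision applies to
  \<open>n * (2/3 - A)\<close> with \<open>n\<close> large. It separates \<open>A \<ge> 2/3\<close> from \<open>A \<le> 2/3 - 2/n\<close>, and self-improvement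
  over the remaining distance, almost \<open>1/3\<close>, gives the bound \<open>1 / (6 * occ A)\<close>. Conversely, a
  restricted formula \<open>p\<close> may leave \<open>[0,1]\<close> and has rational coefficients, but after clearing
  denominators every truncation of an integer multiple of \<open>p\<close> to \<open>[0,1]\<close> is the value of a
  Lukasiewicz formula (\<open>definable_rval_multiple\<close>). The truncation of a large negative multiple
  separates \<open>p < - \<delta>\<close> from \<open>p > 0\<close>, and self-improvement gives \<open>e a c \<ge> p / (2 * v_of p)\<close>.
\<close>

section \<open>Suprema and infima of real functions\<close>

lemma SUP_one_minus:
  fixes f :: "'a \<Rightarrow> real"
  assumes "M \<noteq> {}" "bdd_below (f ` M)"
  shows "(SUP a\<in>M. 1 - f a) = 1 - (INF a\<in>M. f a)"
  using continuous_at_Inf_antimono[of "\<lambda>t::real. 1 - t" "f ` M"] assms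
  by (simp add: image_comp antimono_def continuous_intros)

lemma SUP_le_SUP_add:
  fixes f g :: "'a \<Rightarrow> real"
  assumes "M \<noteq> {}" "bdd_above (g ` M)" "\<And>a. a \<in> M \<Longrightarrow> f a \<le> g a + c"
  shows "(SUP a\<in>M. f a) \<le> (SUP a\<in>M. g a) + c"
  using assms(1)
proof (rule cSUP_least)
  fix a assume a: "a \<in> M"
  show "f a \<le> (SUP a\<in>M. g a) + c"
    using cSUP_upper[OF a assms(2)] assms(3)[OF a] by linarith
qed

lemma INF_le_INF_add:
  fixes f g :: "'a \<Rightarrow> real"
  assumes "M \<noteq> {}" "bdd_below (f ` M)" "\<And>a. a \<in> M \<Longrightarrow> f a \<le> g a + c"
  shows "(INF a\<in>M. f a) \<le> (INF a\<in>M. g a) + c"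
proof -
  have "(INF a\<in>M. f a) - c \<le> (INF a\<in>M. g a)"
    using assms(1)
  proof (rule cINF_greatest)
    fix a assume a: "a \<in> M"
    show "(INF a\<in>M. f a) - c \<le> g a"
      using cINF_lower[OF assms(2) a] assms(3)[OF a] by linarith
  qed
  then show ?thesis by linarith
qed

lemma abs_SUP_diff_le:
  fixes f g :: "'a \<Rightarrow> real"
  assumes "M \<noteq> {}" "bdd_above (f ` M)" "bdd_above (g ` M)"
    and "\<And>a. a \<in> M \<Longrightarrow> \<bar>f a - g a\<bar> \<le> c"
  shows "\<bar>(SUP a\<in>M. f a) - (SUP a\<in>M. g a)\<bar> \<le> c"
proof -
  have "(SUP a\<in>M. f a) \<le> (SUP a\<in>M. g a) + c"
    by (rule SUP_le_SUP_add[OF assms(1,3)]) (use assms(4) in fastforce)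
  moreover have "(SUP a\<in>M. g a) \<le> (SUP a\<in>M. f a) + c"
    by (rule SUP_le_SUP_add[OF assms(1,2)]) (use assms(4) in fastforce)
  ultimately show ?thesis by linarith
qed

lemma abs_INF_diff_le:
  fixes f g :: "'a \<Rightarrow> real"
  assumes "M \<noteq> {}" "bdd_below (f ` M)" "bdd_below (g ` M)"
    and "\<And>a. a \<in> M \<Longrightarrow> \<bar>f a - g a\<bar> \<le> c"
  shows "\<bar>(INF a\<in>M. f a) - (INF a\<in>M. g a)\<bar> \<le> c"
proof -
  have "(INF a\<in>M. f a) \<le> (INF a\<in>M. g a) + c"
    by (rule INF_le_INF_add[OF assms(1,2)]) (use assms(4) in fastforce)
  moreover have "(INF a\<in>M. g a) \<le> (INF a\<in>M. f a) + c"
    by (rule INF_le_INF_add[OF assms(1,3)]) (use assms(4) in fastforce)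
  ultimately show ?thesis by linarith
qed

lemma abs_SUP_le:
  fixes f :: "'a \<Rightarrow> real"
  assumes "M \<noteq> {}" "\<And>a. a \<in> M \<Longrightarrow> \<bar>f a\<bar> \<le> c"
  shows "\<bar>SUP a\<in>M. f a\<bar> \<le> c"
proof -
  have "bdd_above (f ` M)"
    using assms(2) by (intro bdd_aboveI2[of _ _ c]) (auto simp: abs_le_iff)
  moreover have "bdd_above ((\<lambda>_. 0 :: real) ` M)" by (rule bdd_aboveI2[of _ _ 0]) simp
  ultimately show ?thesis
    using abs_SUP_diff_le[OF assms(1), of f "\<lambda>_. 0" c] assms by simp
qed

lemma abs_INF_le:
  fixes f :: "'a \<Rightarrow> real"
  assumes "M \<noteq> {}" "\<And>a. a \<in> M \<Longrightarrow> \<bar>f a\<bar> \<le> c"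
  shows "\<bar>INF a\<in>M. f a\<bar> \<le> c"
proof -
  have "bdd_below (f ` M)"
    using assms(2) by (intro bdd_belowI2[of _ "- c"]) (fastforce simp: abs_le_iff)
  moreover have "bdd_below ((\<lambda>_. 0 :: real) ` M)" by (rule bdd_belowI2[of _ 0]) simp
  ultimately show ?thesis
    using abs_INF_diff_le[OF assms(1), of f "\<lambda>_. 0" c] assms by simp
qed

lemma INF_le_iff_approx:
  fixes g :: "'a \<Rightarrow> real"
  assumes "M \<noteq> {}" "bdd_below (g ` M)"
    and Q: "\<And>c \<delta>. c \<in> M \<Longrightarrow> 0 < \<delta> \<Longrightarrow> g c \<le> u + \<delta> \<longleftrightarrow> Q c \<delta>"
  shows "(INF c\<in>M. g c) \<le> u \<longleftrightarrow> (\<forall>\<delta>>0. \<exists>c\<in>M. Q c \<delta>)"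
proof (intro iffI allI impI)
  fix \<delta> :: real assume "(INF c\<in>M. g c) \<le> u" and \<delta>: "0 < \<delta>"
  then have "(INF c\<in>M. g c) < u + \<delta>" by linarith
  then obtain c where c: "c \<in> M" "g c < u + \<delta>"
    by (auto simp: cINF_less_iff[OF assms(1,2)])
  with Q[OF c(1) \<delta>] show "\<exists>c\<in>M. Q c \<delta>" by (intro bexI[of _ c]) simp_all
next
  assume *: "\<forall>\<delta>>0. \<exists>c\<in>M. Q c \<delta>"
  show "(INF c\<in>M. g c) \<le> u"
  proof (rule field_le_epsilon)
    fix \<delta> :: real assume \<delta>: "0 < \<delta>"
    with * obtain c where c: "c \<in> M" "Q c \<delta>" by blast
    with Q[OF c(1) \<delta>] show "(INF c\<in>M. g c) \<le> u + \<delta>"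
      by (intro cINF_lower2[OF assms(2) c(1)]) simp
  qed
qed

lemma le_SUP_iff_approx:
  fixes g :: "'a \<Rightarrow> real"
  assumes "M \<noteq> {}" "bdd_above (g ` M)"
    and Q: "\<And>c \<delta>. c \<in> M \<Longrightarrow> 0 < \<delta> \<Longrightarrow> u - \<delta> \<le> g c \<longleftrightarrow> Q c \<delta>"
  shows "u \<le> (SUP c\<in>M. g c) \<longleftrightarrow> (\<forall>\<delta>>0. \<exists>c\<in>M. Q c \<delta>)"
proof (intro iffI allI impI)
  fix \<delta> :: real assume "u \<le> (SUP c\<in>M. g c)" and \<delta>: "0 < \<delta>"
  then have "u - \<delta> < (SUP c\<in>M. g c)" by linarith
  then obtain c where c: "c \<in> M" "u - \<delta> < g c"
    by (auto simp: less_cSUP_iff[OF assms(1,2)])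
  with Q[OF c(1) \<delta>] show "\<exists>c\<in>M. Q c \<delta>" by (intro bexI[of _ c]) simp_all
next
  assume *: "\<forall>\<delta>>0. \<exists>c\<in>M. Q c \<delta>"
  show "u \<le> (SUP c\<in>M. g c)"
  proof (rule field_le_epsilon)
    fix \<delta> :: real assume \<delta>: "0 < \<delta>"
    with * obtain c where c: "c \<in> M" "Q c \<delta>" by blast
    have "u - \<delta> \<le> g c" using Q[OF c(1) \<delta>] c(2) by simp
    also have "g c \<le> (SUP c\<in>M. g c)" by (rule cSUP_upper[OF c(1) assms(2)])
    finally show "u \<le> (SUP c\<in>M. g c) + \<delta>" by linarith
  qed
qed

definition clamp :: "real \<Rightarrow> real" where
  "clamp t = max 0 (min t 1)"

text \<open>
  Truncation is monotone and continuous, hence it commutes with suprema.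
\<close>

lemma clamp_SUP:
  assumes "M \<noteq> {}" "bdd_above (f ` M)"
  shows "clamp ((SUP a\<in>M. f a) + c) = (SUP a\<in>M. clamp (f a + c))"
proof -
  have "mono (\<lambda>t. clamp (t + c))" by (auto simp: mono_def clamp_def)
  moreover have "isCont (\<lambda>t. clamp (t + c)) x" for x
    unfolding clamp_def by (intro continuous_intros)
  ultimately show ?thesis
    using continuous_at_Sup_mono[of "\<lambda>t. clamp (t + c)" "f ` M"] assms
    by (simp add: image_comp continuous_at_imp_continuous_at_within)
qed

section \<open>Values of formulas and the pseudometric\<close>

locale Le_model =
  fixes M :: "'a set" and e :: "'a \<Rightarrow> 'a \<Rightarrow> real"
  assumes Le: "Le_structure M e"
begin

abbreviation dd :: "'a \<Rightarrow> 'a \<Rightarrow> real" where "dd \<equiv> d_e M e"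
abbreviation assignment :: "(nat \<Rightarrow> 'a) \<Rightarrow> bool" where "assignment s \<equiv> range s \<subseteq> M"

lemma M_nonempty: "M \<noteq> {}"
  using Le by (simp add: Le_structure_def)

lemma e_bounds: "x \<in> M \<Longrightarrow> y \<in> M \<Longrightarrow> 0 \<le> e x y \<and> e x y \<le> 1"
  using Le by (simp add: Le_structure_def)

lemma assignment_upd: "assignment s \<Longrightarrow> a \<in> M \<Longrightarrow> assignment (s(x := a))"
  by auto

lemmas lval_connectives = lval_derived[OF Le]

lemma lval_bdd:
  assumes "assignment s"
  shows "bdd_above ((\<lambda>a. lval M e A (s(x := a))) ` M)"
    and "bdd_below ((\<lambda>a. lval M e A (s(x := a))) ` M)"
  using lval_bounds[OF Le assignment_upd[OF assms]]
  by (auto intro!: bdd_aboveI2[of _ _ 1] bdd_belowI2[of _ 0])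

lemma v_of_nonneg: "0 \<le> v_of p"
  by (induction p) auto

lemma of_rat_max: "real_of_rat (max a b) = max (of_rat a) (of_rat b)"
  by (simp add: max_def of_rat_less_eq)

lemma abs_rval_le: "assignment s \<Longrightarrow> \<bar>rval M e p s\<bar> \<le> of_rat (v_of p)"
proof (induction p arbitrary: s)
  case (RE x y)
  then have "s x \<in> M" "s y \<in> M" by auto
  then show ?case using e_bounds[of "s x" "s y"] by simp
next
  case (RAdd p q)
  from RAdd.IH[OF RAdd.prems] show ?case by (simp add: of_rat_add)
next
  case (RMax p q)
  from RMax.IH[OF RMax.prems] show ?case by (auto simp: of_rat_max)
next
  case (RMin p q)
  from RMin.IH[OF RMin.prems] show ?case by (auto simp: of_rat_max)
next
  case (RScale r p)
  from RScale.IH[OF RScale.prems] show ?case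
    by (simp add: of_rat_mult abs_mult mult_left_mono)
next
  case (RSup x p)
  have "\<bar>rval M e p (s(x := a))\<bar> \<le> of_rat (v_of p)" if "a \<in> M" for a
    using RSup.IH assignment_upd[OF RSup.prems that] .
  then show ?case by (simp add: abs_SUP_le[OF M_nonempty])
next
  case (RInf x p)
  have "\<bar>rval M e p (s(x := a))\<bar> \<le> of_rat (v_of p)" if "a \<in> M" for a
    using RInf.IH assignment_upd[OF RInf.prems that] .
  then show ?case by (simp add: abs_INF_le[OF M_nonempty])
qed simp

lemma rval_bdd:
  assumes "assignment s"
  shows "bdd_above ((\<lambda>a. rval M e p (s(x := a))) ` M)"
    and "bdd_below ((\<lambda>a. rval M e p (s(x := a))) ` M)"
  using abs_rval_le[OF assignment_upd[OF assms]]
  by (auto simp: abs_le_iff intro!: bdd_aboveI2[of _ _ "of_rat (v_of p)"] bdd_belowI2[of _ "- of_rat (v_of p)"])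
     (smt (verit))

lemma dd_upper:
  assumes "x \<in> M" "y \<in> M" "z \<in> M"
  shows "\<bar>e z x - e z y\<bar> \<le> dd x y"
  unfolding d_e_def
proof (rule cSUP_upper[OF assms(3)])
  have "\<bar>e w x - e w y\<bar> \<le> 1" if "w \<in> M" for w
    using e_bounds[OF that assms(1)] e_bounds[OF that assms(2)] by linarith
  then show "bdd_above ((\<lambda>z. \<bar>e z x - e z y\<bar>) ` M)" by (rule bdd_aboveI2)
qed

lemma dd_nonneg: "x \<in> M \<Longrightarrow> y \<in> M \<Longrightarrow> 0 \<le> dd x y"
  using dd_upper[of x y x] by linarith

lemma dd_refl: "x \<in> M \<Longrightarrow> dd x x = 0"
  unfolding d_e_def using M_nonempty by simp

lemma dd_sym: "dd x y = dd y x"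
  unfolding d_e_def by (simp add: abs_minus_commute)

lemma dd_triangle:
  assumes "x \<in> M" "y \<in> M" "z \<in> M"
  shows "dd x z \<le> dd x y + dd y z"
proof -
  have "\<bar>e w x - e w z\<bar> \<le> dd x y + dd y z" if "w \<in> M" for w
    using dd_upper[OF assms(1,2) that] dd_upper[OF assms(2,3) that] by linarith
  then show ?thesis
    unfolding d_e_def[of M e x z] by (intro cSUP_least[OF M_nonempty])
qed

section \<open>The extensionality sentence\<close>

text \<open>
  Satisfaction quantifies over all assignments, so an outer universal quantifier is redundant.
  This disposes of the parameter list of an excision sentence without substitutions.
\<close>

lemma lsat_LAll: "lsat M e (LAll x A) \<longleftrightarrow> lsat M e A"
proof
  assume L: "lsat M e (LAll x A)"
  show "lsat M e A"
    unfolding lsat_def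
  proof (intro allI impI)
    fix s :: "nat \<Rightarrow> 'a" assume s: "assignment s"
    then have "s x \<in> M" by auto
    have "1 = (INF a\<in>M. lval M e A (s(x := a)))"
      using L s by (simp add: lsat_def)
    also have "\<dots> \<le> lval M e A (s(x := s x))"
      using lval_bdd(2)[OF s] \<open>s x \<in> M\<close> by (rule cINF_lower)
    finally show "lval M e A s = 1" using lval_bounds[OF Le s, of A] by simp
  qed
next
  assume "lsat M e A"
  then show "lsat M e (LAll x A)"
    using assignment_upd M_nonempty by (simp add: lsat_def)
qed

lemma lsat_foldr_LAll: "lsat M e (foldr LAll ys A) \<longleftrightarrow> lsat M e A"
  by (induction ys) (simp_all add: lsat_LAll)

lemma lsat_H_ext_sentence: "lsat M e H_ext_sentence \<longleftrightarrow> H_extensional M e"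
proof -
  let ?R = "LEx 2 (LEq 0 2 \<odot>l LIn 2 1 \<odot>l LIn 2 1)"
  let ?h = "\<lambda>x y. INF z\<in>M. min (dd x z + 2 * e z y) 1"
  have R: "lval M e ?R s = 1 - ?h (s 0) (s 1)" if s: "assignment s" for s
  proof -
    have xy: "s 0 \<in> M" "s 1 \<in> M" using s by auto
    have "lval M e ?R s = (SUP z\<in>M. 1 - min (dd (s 0) z + 2 * e z (s 1)) 1)"
      unfolding lval.simps
    proof (rule SUP_cong[OF refl])
      fix z assume z: "z \<in> M"
      have "lval M e (LEq 0 2 \<odot>l LIn 2 1 \<odot>l LIn 2 1) (s(2 := z)) =
          max (1 - dd (s 0) z + max (1 - e z (s 1) + (1 - e z (s 1)) - 1) 0 - 1) 0"
        using assignment_upd[OF s z, of 2] by (simp add: lval_connectives lval_LEq[OF Le])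
      then show "lval M e (LEq 0 2 \<odot>l LIn 2 1 \<odot>l LIn 2 1) (s(2 := z)) =
          1 - min (dd (s 0) z + 2 * e z (s 1)) 1"
        using dd_nonneg[OF xy(1) z] by (simp add: max_def min_def)
    qed
    also have "\<dots> = 1 - ?h (s 0) (s 1)"
    proof (rule SUP_one_minus[OF M_nonempty])
      show "bdd_below ((\<lambda>z. min (dd (s 0) z + 2 * e z (s 1)) 1) ` M)"
        using dd_nonneg xy e_bounds by (intro bdd_belowI2[of _ 0]) auto
    qed
    finally show ?thesis .
  qed
  have "lsat M e H_ext_sentence \<longleftrightarrow> lsat M e (LIff (LIn 0 1) ?R)"
    by (simp add: H_ext_sentence_def Let_def lsat_LAll)
  also have "\<dots> \<longleftrightarrow> (\<forall>s. assignment s \<longrightarrow> e (s 0) (s 1) = ?h (s 0) (s 1))"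
    unfolding lsat_def by (auto simp: lval_connectives R simp del: lval.simps(4) One_nat_def)
  also have "\<dots> \<longleftrightarrow> H_extensional M e"
    unfolding H_extensional_def
  proof (intro iffI ballI allI impI)
    fix x y assume A: "\<forall>s. assignment s \<longrightarrow> e (s 0) (s 1) = ?h (s 0) (s 1)" "x \<in> M" "y \<in> M"
    then show "e x y = ?h x y"
      using A(1)[rule_format, of "\<lambda>n::nat. if n = 0 then x else y"] by auto
  next
    fix s :: "nat \<Rightarrow> 'a"
    assume "\<forall>x\<in>M. \<forall>y\<in>M. e x y = ?h x y" "assignment s"
    then show "e (s 0) (s 1) = ?h (s 0) (s 1)" by blast
  qed
  finally show ?thesis .
qed

section \<open>Functions definable by Lukasiewicz formulas\<close>

text \<open>
  Lukasiewicz formulas only take values in \<open>[0,1]\<close>, so a function \<open>f\<close> that may leave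
  this interval is represented by its slices: the truncations of all its integer shifts. Keeping
  every slice is what makes the class closed under addition.
\<close>

definition definable :: "nat set \<Rightarrow> ((nat \<Rightarrow> 'a) \<Rightarrow> real) \<Rightarrow> bool" where
  "definable V f \<longleftrightarrow> (\<forall>b::int. \<exists>A. lfv A \<subseteq> V \<and>
     (\<forall>s. assignment s \<longrightarrow> lval M e A s = clamp (f s + of_int b)))"

lemma definable_cong:
  "(\<And>s. assignment s \<Longrightarrow> f s = g s) \<Longrightarrow> definable V f \<Longrightarrow> definable V g"
  unfolding definable_def by metis

lemma definable_mono: "V \<subseteq> W \<Longrightarrow> definable V f \<Longrightarrow> definable W f"
  unfolding definable_def by (meson subset_trans)

lemma definable_const: "definable V (\<lambda>s. of_int c)"
  unfolding definable_def
proof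
  fix b
  show "\<exists>A. lfv A \<subseteq> V \<and> (\<forall>s. assignment s \<longrightarrow> lval M e A s = clamp (of_int c + of_int b))"
    by (rule exI[of _ "if c + b \<le> 0 then LBot else LTop"])
       (auto simp: lval_connectives LTop_def clamp_def simp flip: of_int_add)
qed

lemma definable_lval:
  assumes "lfv A \<subseteq> V"
  shows "definable V (lval M e A)"
  unfolding definable_def
proof
  fix b :: int
  have "lval M e (if b = 0 then A else if b < 0 then LBot else LTop) s = clamp (lval M e A s + of_int b)"
    if "assignment s" for s
  proof -
    consider "b = 0" | "real_of_int b \<le> -1" "b < 0" | "real_of_int b \<ge> 1" "b > 0" by force
    then show ?thesis
      using lval_bounds[OF Le that, of A] by cases (auto simp: clamp_def LTop_def)
  qed
  then show "\<exists>B. lfv B \<subseteq> V \<and> (\<forall>s. assignment s \<longrightarrow> lval M e B s = clamp (lval M e A s + of_int b))"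
    using assms by (intro exI[of _ "if b = 0 then A else if b < 0 then LBot else LTop"]) (auto simp: LTop_def)
qed

lemma definable_shift:
  assumes "definable V f"
  shows "definable V (\<lambda>s. f s + of_int c)"
  unfolding definable_def
proof
  fix b
  show "\<exists>B. lfv B \<subseteq> V \<and> (\<forall>s. assignment s \<longrightarrow> lval M e B s = clamp (f s + of_int c + of_int b))"
    using assms[unfolded definable_def, rule_format, of "c + b"] by (simp add: add.assoc)
qed

lemma definable_uminus:
  assumes "definable V f"
  shows "definable V (\<lambda>s. - f s)"
  unfolding definable_def
proof
  fix b
  obtain A where A: "lfv A \<subseteq> V" "\<And>s. assignment s \<Longrightarrow> lval M e A s = clamp (f s + of_int (1 - b))"
    using assms unfolding definable_def by blast
  then show "\<exists>B. lfv B \<subseteq> V \<and> (\<forall>s. assignment s \<longrightarrow> lval M e B s = clamp (- f s + of_int b))"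
    by (intro exI[of _ "LNot A"]) (auto simp: lval_connectives LNot_def clamp_def)
qed

lemma definable_max:
  assumes "definable V f" "definable V g"
  shows "definable V (\<lambda>s. max (f s) (g s))"
  unfolding definable_def
proof
  fix b
  obtain A where A: "lfv A \<subseteq> V" "\<And>s. assignment s \<Longrightarrow> lval M e A s = clamp (f s + of_int b)"
    using assms(1) unfolding definable_def by blast
  obtain B where B: "lfv B \<subseteq> V" "\<And>s. assignment s \<Longrightarrow> lval M e B s = clamp (g s + of_int b)"
    using assms(2) unfolding definable_def by blast
  have "lfv (LOr A B) \<subseteq> V" using A B by (auto simp: LOr_def)
  moreover have "lval M e (LOr A B) s = clamp (max (f s) (g s) + of_int b)" if "assignment s" for s
    using that by (simp add: lval_connectives A B) (auto simp: clamp_def)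
  ultimately show "\<exists>C. lfv C \<subseteq> V \<and> (\<forall>s. assignment s \<longrightarrow> lval M e C s = clamp (max (f s) (g s) + of_int b))"
    by blast
qed

lemma definable_min:
  assumes "definable V f" "definable V g"
  shows "definable V (\<lambda>s. min (f s) (g s))"
  by (rule definable_cong[OF _ definable_uminus[OF definable_max[OF assms[THEN definable_uminus]]]]) auto

text \<open>
  If \<open>f + b \<ge> 0\<close> then the slice of \<open>f\<close> at \<open>b + 1\<close> is \<open>1\<close>, and the sum is obtained by \<open>\<oplus>l\<close> from the slice
  at \<open>b\<close>; if \<open>-1 \<le> f + b \<le> 0\<close> then the slice at \<open>b\<close> vanishes, and the sum is obtained by \<open>\<odot>l\<close> from the
  slice at \<open>b + 1\<close>. One formula covers both cases, and gives \<open>0\<close> if \<open>f + b \<le> -1\<close>.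
\<close>

lemma definable_add_lval:
  assumes "definable V f" "lfv A \<subseteq> V"
  shows "definable V (\<lambda>s. f s + lval M e A s)"
  unfolding definable_def
proof
  fix b
  obtain X where X: "lfv X \<subseteq> V" "\<And>s. assignment s \<Longrightarrow> lval M e X s = clamp (f s + of_int b)"
    using assms(1) unfolding definable_def by blast
  obtain Y where Y: "lfv Y \<subseteq> V" "\<And>s. assignment s \<Longrightarrow> lval M e Y s = clamp (f s + of_int (b + 1))"
    using assms(1) unfolding definable_def by blast
  have "lfv (X \<oplus>l (Y \<odot>l A)) \<subseteq> V" using X Y assms by (auto simp: LPlus_def LStrong_def LNot_def)
  moreover have "lval M e (X \<oplus>l (Y \<odot>l A)) s = clamp (f s + lval M e A s + of_int b)"
    if "assignment s" for s
    using that lval_bounds[OF Le that, of A]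
    by (simp add: lval_connectives X Y) (auto simp: clamp_def max_def min_def)
  ultimately show "\<exists>C. lfv C \<subseteq> V \<and> (\<forall>s. assignment s \<longrightarrow> lval M e C s = clamp (f s + lval M e A s + of_int b))"
    by blast
qed

text \<open>
  A function with values in \<open>[0,n+1]\<close> is the sum of its truncation to \<open>[0,1]\<close>, which is the value
  of a single formula, and a definable function with values in \<open>[0,n]\<close>.
\<close>

lemma definable_add_bounded_nonneg:
  fixes n :: nat
  assumes "definable V f" "definable V g" "\<And>s. assignment s \<Longrightarrow> 0 \<le> g s \<and> g s \<le> real n"
  shows "definable V (\<lambda>s. f s + g s)"
  using assms
proof (induction n arbitrary: f g)
  case 0
  show ?case by (rule definable_cong[OF _ 0(1)]) (use 0(3) in force)
next
  case (Suc n)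
  obtain A where A: "lfv A \<subseteq> V" "\<And>s. assignment s \<Longrightarrow> lval M e A s = clamp (g s)"
    using Suc.prems(2)[unfolded definable_def, rule_format, of 0] by auto
  have "definable V (\<lambda>s. max (g s + of_int (- 1)) (of_int 0))"
    by (intro definable_max definable_shift definable_const Suc.prems)
  then have "definable V (\<lambda>s. (f s + lval M e A s) + max (g s + of_int (- 1)) (of_int 0))"
    by (intro Suc.IH definable_add_lval Suc.prems A(1)) (use Suc.prems(3) in fastforce)+
  then show ?case
    by (rule definable_cong[rotated]) (use Suc.prems(3) in \<open>auto simp: A clamp_def\<close>)
qed

lemma definable_add:
  assumes f: "definable V f" and g: "definable V g"
    and bd: "\<And>s. assignment s \<Longrightarrow> \<bar>g s\<bar> \<le> B"
  shows "definable V (\<lambda>s. f s + g s)"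
proof -
  obtain n :: nat where n: "B \<le> real n" using real_arch_simple by blast
  have "definable V (\<lambda>s. (f s + of_int (- int n)) + (g s + of_int (int n)))"
  proof (rule definable_add_bounded_nonneg)
    fix s assume "assignment s"
    then show "0 \<le> g s + of_int (int n) \<and> g s + of_int (int n) \<le> real (2 * n)"
      using bd[of s] n by (simp add: abs_le_iff)
  qed (intro definable_shift f g)+
  then show ?thesis by (rule definable_cong[rotated]) simp
qed

lemma definable_mult_int:
  assumes f: "definable V f" and bd: "\<And>s. assignment s \<Longrightarrow> \<bar>f s\<bar> \<le> B"
  shows "definable V (\<lambda>s. of_int k * f s)"
proof -
  have nat: "definable V (\<lambda>s. real n * f s)" for n
  proof (induction n)
    case 0
    show ?case using definable_const[of V 0] by simp
  next
    case (Suc n)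
    from definable_add[OF this f bd] show ?case by (simp add: algebra_simps)
  qed
  show ?thesis
  proof (cases "k \<ge> 0")
    case True
    then show ?thesis using nat[of "nat k"] by simp
  next
    case False
    then show ?thesis using definable_uminus[OF nat[of "nat (-k)"]] by simp
  qed
qed

lemma definable_SUP:
  assumes f: "definable V f" and bd: "\<And>s. assignment s \<Longrightarrow> \<bar>f s\<bar> \<le> B"
  shows "definable (V - {x}) (\<lambda>s. SUP a\<in>M. f (s(x := a)))"
  unfolding definable_def
proof
  fix b
  obtain A where A: "lfv A \<subseteq> V" "\<And>s. assignment s \<Longrightarrow> lval M e A s = clamp (f s + of_int b)"
    using f unfolding definable_def by blast
  have "lval M e (LEx x A) s = clamp ((SUP a\<in>M. f (s(x := a))) + of_int b)" if s: "assignment s" for s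
  proof -
    have "bdd_above ((\<lambda>a. f (s(x := a))) ` M)"
      using bd[OF assignment_upd[OF s]] by (intro bdd_aboveI2[of _ _ B]) (auto simp: abs_le_iff)
    then show ?thesis
      using A(2)[OF assignment_upd[OF s]] by (simp add: clamp_SUP[OF M_nonempty])
  qed
  then show "\<exists>C. lfv C \<subseteq> V - {x} \<and>
      (\<forall>s. assignment s \<longrightarrow> lval M e C s = clamp ((SUP a\<in>M. f (s(x := a))) + of_int b))"
    using A(1) by (intro exI[of _ "LEx x A"]) auto
qed

lemma definable_INF:
  assumes f: "definable V f" and bd: "\<And>s. assignment s \<Longrightarrow> \<bar>f s\<bar> \<le> B"
  shows "definable (V - {x}) (\<lambda>s. INF a\<in>M. f (s(x := a)))"
proof -
  have "definable (V - {x}) (\<lambda>s. - (SUP a\<in>M. - f (s(x := a))))"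
    by (rule definable_uminus[OF definable_SUP[OF definable_uminus[OF f]]]) (use bd in auto)
  then show ?thesis by (simp add: Inf_real_def image_comp)
qed

text \<open>
  Lukasiewicz logic has no rational constants, so a denominator has to be cleared for each
  occurrence of scaling. Allowing all further integer factors \<open>k\<close> is needed to bring the two
  arguments of a binary connective to a common multiplier, and later to steepen the function.
\<close>

lemma definable_rval_multiple:
  "\<exists>N::int. 1 \<le> N \<and> (\<forall>k. definable (rfv p) (\<lambda>s. of_int (k * N) * rval M e p s))"
proof -
  have lift: "\<forall>k. definable V (\<lambda>s. of_int (k * N) * rval M e p s)"
    if "definable V (\<lambda>s. of_int N * rval M e p s)" for V p and N :: int
  proof
    fix k
    have "\<bar>of_int N * rval M e p s\<bar> \<le> \<bar>of_int N\<bar> * of_rat (v_of p)" if "assignment s" for s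
      using abs_rval_le[OF that] by (simp add: abs_mult mult_left_mono)
    from definable_mult_int[OF \<open>definable V _\<close> this]
    show "definable V (\<lambda>s. of_int (k * N) * rval M e p s)" by (simp add: mult.assoc)
  qed
  have bound: "\<bar>of_int N * rval M e p s\<bar> \<le> \<bar>of_int N\<bar> * of_rat (v_of p)"
    if "assignment s" for p s and N :: int
    using abs_rval_le[OF that] by (simp add: abs_mult mult_left_mono)
  show ?thesis
  proof (induction p)
    case (RE x y)
    have "definable {x, y} (\<lambda>s. - lval M e (LIn x y) s + of_int 1)"
      by (intro definable_shift definable_uminus definable_lval) simp
    then show ?case by (intro exI[of _ 1] conjI lift) simp_all
  next
    case ROne
    show ?case using definable_const[of "{}" 1] by (intro exI[of _ 1] conjI lift) simp_all
  next
    case (RAdd p q)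
    then obtain N1 N2 :: int where N: "1 \<le> N1" "1 \<le> N2"
      and p: "definable (rfv p) (\<lambda>s. of_int (N2 * N1) * rval M e p s)"
      and q: "definable (rfv q) (\<lambda>s. of_int (N1 * N2) * rval M e q s)" by blast
    have "definable (rfv (RAdd p q))
        (\<lambda>s. of_int (N2 * N1) * rval M e p s + of_int (N1 * N2) * rval M e q s)"
      by (rule definable_add[OF definable_mono[OF _ p] definable_mono[OF _ q] bound]) auto
    then have "definable (rfv (RAdd p q)) (\<lambda>s. of_int (N1 * N2) * rval M e (RAdd p q) s)"
      by (simp add: algebra_simps)
    moreover have "1 \<le> N1 * N2" using N mult_mono[of 1 N1 1 N2] by simp
    ultimately show ?case using lift by blast
  next
    case (RMax p q)
    then obtain N1 N2 :: int where N: "1 \<le> N1" "1 \<le> N2"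
      and p: "definable (rfv p) (\<lambda>s. of_int (N2 * N1) * rval M e p s)"
      and q: "definable (rfv q) (\<lambda>s. of_int (N1 * N2) * rval M e q s)" by blast
    have pos: "1 \<le> N1 * N2" using N mult_mono[of 1 N1 1 N2] by simp
    have "definable (rfv (RMax p q))
        (\<lambda>s. max (of_int (N2 * N1) * rval M e p s) (of_int (N1 * N2) * rval M e q s))"
      by (rule definable_max[OF definable_mono[OF _ p] definable_mono[OF _ q]]) auto
    then have "definable (rfv (RMax p q)) (\<lambda>s. of_int (N1 * N2) * rval M e (RMax p q) s)"
      using pos N by (simp add: max_mult_distrib_left mult.commute)
    with pos show ?case using lift by blast
  next
    case (RMin p q)
    then obtain N1 N2 :: int where N: "1 \<le> N1" "1 \<le> N2"
      and p: "definable (rfv p) (\<lambda>s. of_int (N2 * N1) * rval M e p s)"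
      and q: "definable (rfv q) (\<lambda>s. of_int (N1 * N2) * rval M e q s)" by blast
    have pos: "1 \<le> N1 * N2" using N mult_mono[of 1 N1 1 N2] by simp
    have "definable (rfv (RMin p q))
        (\<lambda>s. min (of_int (N2 * N1) * rval M e p s) (of_int (N1 * N2) * rval M e q s))"
      by (rule definable_min[OF definable_mono[OF _ p] definable_mono[OF _ q]]) auto
    then have "definable (rfv (RMin p q)) (\<lambda>s. of_int (N1 * N2) * rval M e (RMin p q) s)"
      using pos N by (simp add: min_mult_distrib_left mult.commute)
    with pos show ?case using lift by blast
  next
    case (RScale r p)
    obtain a b where ab: "quotient_of r = (a, b)" by fastforce
    then have b: "b > 0" and r: "r = of_int a / of_int b"
      using quotient_of_denom_pos quotient_of_div by blast+
    from RScale obtain N :: int where N: "1 \<le> N"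
      and p: "definable (rfv p) (\<lambda>s. of_int (a * N) * rval M e p s)" by blast
    have "of_int (N * b) * rval M e (RScale r p) s = of_int (a * N) * rval M e p s" for s
    proof -
      have "of_int b * real_of_rat r = of_int a" using b by (simp add: r of_rat_divide)
      then show ?thesis by (simp add: algebra_simps)
    qed
    with p have "definable (rfv (RScale r p)) (\<lambda>s. of_int (N * b) * rval M e (RScale r p) s)"
      by (simp only: rfv.simps)
    moreover have "1 \<le> N * b" using N b mult_mono[of 1 N 1 b] by simp
    ultimately show ?case using lift by blast
  next
    case (RSup x p)
    then obtain N :: int where N: "1 \<le> N"
      and p: "definable (rfv p) (\<lambda>s. of_int N * rval M e p s)"
      by (metis mult_1)
    have "(SUP a\<in>M. of_int N * rval M e p (s(x := a))) = of_int N * rval M e (RSup x p) s"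
      if s: "assignment s" for s
      using continuous_at_Sup_mono[of "\<lambda>t. of_int N * t" "(\<lambda>a. rval M e p (s(x := a))) ` M"]
        rval_bdd(1)[OF s] M_nonempty N
      by (simp add: image_comp mono_def continuous_intros)
    from definable_cong[OF this definable_SUP[OF p bound]]
    have "definable (rfv (RSup x p)) (\<lambda>s. of_int N * rval M e (RSup x p) s)" by simp
    with N show ?case using lift by blast
  next
    case (RInf x p)
    then obtain N :: int where N: "1 \<le> N"
      and p: "definable (rfv p) (\<lambda>s. of_int N * rval M e p s)"
      by (metis mult_1)
    have "(INF a\<in>M. of_int N * rval M e p (s(x := a))) = of_int N * rval M e (RInf x p) s"
      if s: "assignment s" for s
      using continuous_at_Inf_mono[of "\<lambda>t. of_int N * t" "(\<lambda>a. rval M e p (s(x := a))) ` M"]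
        rval_bdd(2)[OF s] M_nonempty N
      by (simp add: image_comp mono_def continuous_intros)
    from definable_cong[OF this definable_INF[OF p bound]]
    have "definable (rfv (RInf x p)) (\<lambda>s. of_int N * rval M e (RInf x p) s)" by simp
    with N show ?case using lift by blast
  qed
qed

section \<open>Lipschitz continuity and separation under extensionality\<close>

text \<open>
  In the second argument this is the definition of \<open>d_e\<close>. In the first argument it is
  extensionality together with the triangle inequality.
\<close>

lemma e_lipschitz:
  assumes H: "H_extensional M e" and M: "x \<in> M" "x' \<in> M" "y \<in> M" "y' \<in> M"
  shows "\<bar>e x y - e x' y'\<bar> \<le> dd x x' + dd y y'"
proof -
  have "e u y \<le> e u' y + dd u u'" if u: "u \<in> M" "u' \<in> M" for u u'
  proof -
    have eq: "e w y = (INF z\<in>M. min (dd w z + 2 * e z y) 1)" if "w \<in> M" for w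
      by (rule H[unfolded H_extensional_def, rule_format, OF that M(3)])
    show ?thesis
      unfolding eq[OF u(1)] eq[OF u(2)]
    proof (rule INF_le_INF_add[OF M_nonempty])
      show "bdd_below ((\<lambda>z. min (dd u z + 2 * e z y) 1) ` M)"
        using dd_nonneg u M e_bounds by (intro bdd_belowI2[of _ 0]) auto
      fix z assume "z \<in> M"
      then show "min (dd u z + 2 * e z y) 1 \<le> min (dd u' z + 2 * e z y) 1 + dd u u'"
        using dd_triangle[OF u, of z] dd_nonneg[OF u] by linarith
    qed
  qed
  from this[OF M(1,2)] this[OF M(2,1)] have "\<bar>e x y - e x' y\<bar> \<le> dd x x'"
    by (simp add: dd_sym[of x' x])
  with dd_upper[OF M(3,4,2)] show ?thesis by linarith
qed

lemma dd_bound_nonneg: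
  assumes "assignment s" "assignment t" "\<And>n. dd (s n) (t n) \<le> D"
  shows "0 \<le> D"
  using dd_nonneg[of "s 0" "t 0"] assms(1,2) assms(3)[of 0] by (auto simp: image_subset_iff)

text \<open>
  The two assignments may differ at every variable, so that quantified variables need no separate
  treatment. The factor two comes from atomic formulas, whose two arguments both move; in \<open>e(x,x)\<close>
  a change of the single variable \<open>x\<close> already has this effect.
\<close>

lemma lval_lipschitz:
  assumes H: "H_extensional M e"
    and "assignment s" "assignment t" "\<And>n. dd (s n) (t n) \<le> D"
  shows "\<bar>lval M e A s - lval M e A t\<bar> \<le> 2 * real (occ A) * D"
  using assms(2-)
proof (induction A arbitrary: s t)
  case (LIn x y)
  then have "s x \<in> M" "t x \<in> M" "s y \<in> M" "t y \<in> M" by auto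
  from e_lipschitz[OF H this] show ?case using LIn(3)[of x] LIn(3)[of y] by simp
next
  case (LImp A B)
  have "\<bar>lval M e A s - lval M e A t\<bar> \<le> 2 * real (occ A) * D"
    "\<bar>lval M e B s - lval M e B t\<bar> \<le> 2 * real (occ B) * D"
    using LImp.IH[OF LImp.prems] by simp_all
  moreover have "\<bar>lval M e (LImp A B) s - lval M e (LImp A B) t\<bar>
      \<le> \<bar>lval M e A s - lval M e A t\<bar> + \<bar>lval M e B s - lval M e B t\<bar>"
    unfolding lval.simps by linarith
  ultimately show ?case by (simp add: algebra_simps)
next
  case (LEx x A)
  have D: "0 \<le> D" by (rule dd_bound_nonneg[OF LEx.prems])
  have "\<bar>lval M e A (s(x := a)) - lval M e A (t(x := a))\<bar> \<le> 2 * real (occ A) * D"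
    if "a \<in> M" for a
    using that LEx.prems by (intro LEx.IH) (auto simp: dd_refl D)
  then show ?case
    using abs_SUP_diff_le[OF M_nonempty lval_bdd(1)[OF LEx.prems(1)] lval_bdd(1)[OF LEx.prems(2)]]
    by simp
next
  case (LAll x A)
  have D: "0 \<le> D" by (rule dd_bound_nonneg[OF LAll.prems])
  have "\<bar>lval M e A (s(x := a)) - lval M e A (t(x := a))\<bar> \<le> 2 * real (occ A) * D"
    if "a \<in> M" for a
    using that LAll.prems by (intro LAll.IH) (auto simp: dd_refl D)
  then show ?case
    using abs_INF_diff_le[OF M_nonempty lval_bdd(2)[OF LAll.prems(1)] lval_bdd(2)[OF LAll.prems(2)]]
    by simp
qed simp

lemma rval_lipschitz:
  assumes H: "H_extensional M e"
    and "assignment s" "assignment t" "\<And>n. dd (s n) (t n) \<le> D"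
  shows "\<bar>rval M e p s - rval M e p t\<bar> \<le> of_rat (v_of p) * (2 * D)"
  using assms(2-)
proof (induction p arbitrary: s t)
  case (RE x y)
  then have "s x \<in> M" "t x \<in> M" "s y \<in> M" "t y \<in> M" by auto
  from e_lipschitz[OF H this] show ?case using RE(3)[of x] RE(3)[of y] by simp
next
  case ROne
  have D: "0 \<le> D" by (rule dd_bound_nonneg[OF ROne])
  then show ?case by simp
next
  case (RAdd p q)
  have "\<bar>rval M e p s - rval M e p t\<bar> \<le> of_rat (v_of p) * (2 * D)"
    "\<bar>rval M e q s - rval M e q t\<bar> \<le> of_rat (v_of q) * (2 * D)"
    using RAdd.IH[OF RAdd.prems] by simp_all
  then show ?case by (simp add: of_rat_add distrib_right)
next
  case (RMax p q)
  have D: "0 \<le> D" by (rule dd_bound_nonneg[OF RMax.prems])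
  have "\<bar>rval M e p s - rval M e p t\<bar> \<le> of_rat (v_of p) * (2 * D)"
    "\<bar>rval M e q s - rval M e q t\<bar> \<le> of_rat (v_of q) * (2 * D)"
    using RMax.IH[OF RMax.prems] by simp_all
  moreover have "of_rat (v_of p) * (2 * D) \<le> of_rat (v_of (RMax p q)) * (2 * D)"
    "of_rat (v_of q) * (2 * D) \<le> of_rat (v_of (RMax p q)) * (2 * D)"
    using D by (auto intro!: mult_right_mono simp: of_rat_less_eq)
  ultimately show ?case unfolding rval.simps by linarith
next
  case (RMin p q)
  have D: "0 \<le> D" by (rule dd_bound_nonneg[OF RMin.prems])
  have "\<bar>rval M e p s - rval M e p t\<bar> \<le> of_rat (v_of p) * (2 * D)"
    "\<bar>rval M e q s - rval M e q t\<bar> \<le> of_rat (v_of q) * (2 * D)"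
    using RMin.IH[OF RMin.prems] by simp_all
  moreover have "of_rat (v_of p) * (2 * D) \<le> of_rat (v_of (RMin p q)) * (2 * D)"
    "of_rat (v_of q) * (2 * D) \<le> of_rat (v_of (RMin p q)) * (2 * D)"
    using D by (auto intro!: mult_right_mono simp: of_rat_less_eq)
  ultimately show ?case unfolding rval.simps by linarith
next
  case (RScale r p)
  have "\<bar>rval M e (RScale r p) s - rval M e (RScale r p) t\<bar>
      = \<bar>of_rat r\<bar> * \<bar>rval M e p s - rval M e p t\<bar>"
    by (simp only: rval.simps abs_mult flip: right_diff_distrib)
  also have "\<dots> \<le> \<bar>of_rat r\<bar> * (of_rat (v_of p) * (2 * D))"
    by (rule mult_left_mono[OF RScale.IH[OF RScale.prems]]) simp
  also have "\<dots> = of_rat (v_of (RScale r p)) * (2 * D)"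
    by (simp add: of_rat_mult)
  finally show ?case .
next
  case (RSup x p)
  have D: "0 \<le> D" by (rule dd_bound_nonneg[OF RSup.prems])
  have "\<bar>rval M e p (s(x := a)) - rval M e p (t(x := a))\<bar> \<le> of_rat (v_of p) * (2 * D)"
    if "a \<in> M" for a
    using that RSup.prems by (intro RSup.IH) (auto simp: dd_refl D)
  then show ?case
    using abs_SUP_diff_le[OF M_nonempty rval_bdd(1)[OF RSup.prems(1)] rval_bdd(1)[OF RSup.prems(2)]]
    by simp
next
  case (RInf x p)
  have D: "0 \<le> D" by (rule dd_bound_nonneg[OF RInf.prems])
  have "\<bar>rval M e p (s(x := a)) - rval M e p (t(x := a))\<bar> \<le> of_rat (v_of p) * (2 * D)"
    if "a \<in> M" for a
    using that RInf.prems by (intro RInf.IH) (auto simp: dd_refl D)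
  then show ?case
    using abs_INF_diff_le[OF M_nonempty rval_bdd(2)[OF RInf.prems(1)] rval_bdd(2)[OF RInf.prems(2)]]
    by simp
qed

lemma dd_fun_upd:
  assumes "assignment s" "a \<in> M" "b \<in> M"
  shows "dd ((s(x := a)) n) ((s(x := b)) n) \<le> dd a b"
proof -
  have "s n \<in> M" using assms(1) by auto
  then show ?thesis using dd_nonneg[OF assms(2,3)] by (simp add: dd_refl)
qed

text \<open>
  A lower bound \<open>\<epsilon>\<close> improves itself. The function \<open>T\<close> may be as large as \<open>1\<close>, while \<open>\<epsilon>\<close> may be
  arbitrarily small; the proof bounds the largest defect \<open>c\<close> of the desired inequality by
  \<open>max 0 (c - \<epsilon>)\<close>.
\<close>

lemma extensional_lower_bound:
  assumes H: "H_extensional M e" and z: "z \<in> M" and x: "x \<in> M"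
    and le1: "\<And>a. a \<in> M \<Longrightarrow> T a \<le> 1"
    and lip: "\<And>a b. a \<in> M \<Longrightarrow> b \<in> M \<Longrightarrow> T a - T b \<le> dd a b"
    and \<epsilon>: "0 < \<epsilon>" "\<And>a. a \<in> M \<Longrightarrow> 0 < T a \<Longrightarrow> \<epsilon> \<le> e a z"
  shows "T x \<le> e x z"
proof -
  define c where "c = (SUP a\<in>M. T a - e a z)"
  have bdd: "bdd_above ((\<lambda>a. T a - e a z) ` M)"
    using le1 e_bounds[OF _ z] by (intro bdd_aboveI2[of _ _ 1]) fastforce
  have c: "T a - e a z \<le> c" if "a \<in> M" for a
    unfolding c_def using that bdd by (rule cSUP_upper)
  have step: "T a - max 0 (c - \<epsilon>) \<le> e a z" if a: "a \<in> M" for a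
  proof -
    have "T a - max 0 (c - \<epsilon>) \<le> min (dd a w + 2 * e w z) 1" if w: "w \<in> M" for w
    proof (cases "0 < T w")
      case True
      \<comment> \<open>one copy of \<open>e w z\<close> is at least \<open>T w - c\<close>, the other one is at least \<open>\<epsilon>\<close>\<close>
      then show ?thesis using \<epsilon>(2)[OF w] c[OF w] lip[OF a w] le1[OF a] by linarith
    next
      case False
      then show ?thesis using lip[OF a w] le1[OF a] e_bounds[OF w z] by linarith
    qed
    then have "T a - max 0 (c - \<epsilon>) \<le> (INF w\<in>M. min (dd a w + 2 * e w z) 1)"
      by (intro cINF_greatest[OF M_nonempty])
    also have "\<dots> = e a z" by (rule H[unfolded H_extensional_def, rule_format, OF a z, symmetric])
    finally show ?thesis .
  qed
  have "(SUP a\<in>M. T a - e a z) \<le> max 0 (c - \<epsilon>)"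
    using step by (intro cSUP_least[OF M_nonempty]) (simp add: algebra_simps)
  then have "c \<le> max 0 (c - \<epsilon>)" by (simp add: c_def)
  with \<epsilon>(1) have "c \<le> 0" by linarith
  with c[OF x] show ?thesis by linarith
qed

section \<open>Excision in terms of approximate witnesses\<close>

text \<open>
  As for \<open>lsat_LAll\<close>: a statement about all assignments absorbs outer suprema.
\<close>

lemma rval_RSup_nonpos:
  "(\<forall>s. assignment s \<longrightarrow> rval M e (RSup y p) s \<le> 0) \<longleftrightarrow> (\<forall>s. assignment s \<longrightarrow> rval M e p s \<le> 0)"
proof (intro iffI allI impI)
  fix s assume *: "\<forall>s. assignment s \<longrightarrow> rval M e (RSup y p) s \<le> 0" and s: "assignment s"
  then have "s y \<in> M" by auto
  then have "rval M e p (s(y := s y)) \<le> rval M e (RSup y p) s"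
    using cSUP_upper[OF _ rval_bdd(1)[OF s], of "s y" p y] by simp
  with * s show "rval M e p s \<le> 0" by force
next
  fix s assume "\<forall>s. assignment s \<longrightarrow> rval M e p s \<le> 0" and s: "assignment s"
  then show "rval M e (RSup y p) s \<le> 0"
    using assignment_upd[OF s] by (auto intro!: cSUP_least[OF M_nonempty])
qed

lemma rval_foldr_RSup_nonpos:
  "(\<forall>s. assignment s \<longrightarrow> rval M e (foldr RSup ys p) s \<le> 0) \<longleftrightarrow> (\<forall>s. assignment s \<longrightarrow> rval M e p s \<le> 0)"
  by (induction ys) (simp_all add: rval_RSup_nonpos del: rval.simps)

text \<open>
  Infima over \<open>M\<close> need not be attained, so the witness \<open>c\<close> depends on an error \<open>\<delta>\<close>, which affects
  the thresholds as well as the bounds on \<open>e a c\<close>.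
\<close>

lemma excision_form_nonpos_iff:
  assumes xz: "x \<noteq> z" and z: "z \<notin> rfv p"
  shows "(\<forall>s. assignment s \<longrightarrow> rval M e (excision_form p x z ys) s \<le> 0) \<longleftrightarrow>
    (\<forall>s. assignment s \<longrightarrow> (\<forall>\<delta>>0. \<exists>c\<in>M. \<forall>a\<in>M.
      (rval M e p (s(x := a)) < - \<delta> \<longrightarrow> e a c \<le> \<delta>) \<and>
      (1 + \<delta> < rval M e p (s(x := a)) \<longrightarrow> of_rat (eps p) - \<delta> \<le> e a c)))"
proof -
  let ?B = "RMax (RMin (RE x z) (RScale (-1) p))
     (RMin (RAdd (RScale (eps p) ROne) (RScale (-1) (RE x z))) (RAdd p (RScale (-1) ROne)))"
  have B: "rval M e ?B (s(z := c, x := a)) \<le> \<delta> \<longleftrightarrow>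
      (rval M e p (s(x := a)) < - \<delta> \<longrightarrow> e a c \<le> \<delta>) \<and>
      (1 + \<delta> < rval M e p (s(x := a)) \<longrightarrow> of_rat (eps p) - \<delta> \<le> e a c)" for s c a \<delta>
  proof -
    have "rval M e p (s(z := c, x := a)) = rval M e p (s(x := a))"
      using z by (intro rval_cong) auto
    then have "rval M e ?B (s(z := c, x := a)) =
        max (min (e a c) (- rval M e p (s(x := a))))
          (min (of_rat (eps p) - e a c) (rval M e p (s(x := a)) - 1))"
      using xz by simp
    then show ?thesis by linarith
  qed
  have "rval M e (RInf z (RSup x ?B)) s \<le> 0 \<longleftrightarrow> (\<forall>\<delta>>0. \<exists>c\<in>M. \<forall>a\<in>M.
      (rval M e p (s(x := a)) < - \<delta> \<longrightarrow> e a c \<le> \<delta>) \<and>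
      (1 + \<delta> < rval M e p (s(x := a)) \<longrightarrow> of_rat (eps p) - \<delta> \<le> e a c))"
    if s: "assignment s" for s
  proof -
    show ?thesis
      unfolding rval.simps(8)
    proof (rule INF_le_iff_approx[OF M_nonempty rval_bdd(2)[OF s]])
      fix c and \<delta> :: real assume "c \<in> M" "0 < \<delta>"
      have "rval M e (RSup x ?B) (s(z := c)) \<le> \<delta> \<longleftrightarrow>
          (\<forall>a\<in>M. rval M e ?B (s(z := c, x := a)) \<le> \<delta>)"
        unfolding rval.simps(7)
        by (rule cSUP_le_iff[OF M_nonempty rval_bdd(1)[OF assignment_upd[OF s \<open>c \<in> M\<close>]]])
      then show "rval M e (RSup x ?B) (s(z := c)) \<le> 0 + \<delta> \<longleftrightarrow> (\<forall>a\<in>M.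
          (rval M e p (s(x := a)) < - \<delta> \<longrightarrow> e a c \<le> \<delta>) \<and>
          (1 + \<delta> < rval M e p (s(x := a)) \<longrightarrow> of_rat (eps p) - \<delta> \<le> e a c))"
        unfolding B by (simp only: add_0)
    qed
  qed
  then show ?thesis unfolding excision_form_def rval_foldr_RSup_nonpos by (rule all_cong)
qed

lemma lval_LMult:
  assumes "assignment s"
  shows "lval M e (LMult n A) s = (if n = 0 then 1 else min (real n * lval M e A s) 1)"
proof (induction n A rule: LMult.induct)
  case (1 A)
  show ?case by (simp add: lval_connectives[OF assms])
next
  case (2 A)
  show ?case using lval_bounds[OF Le assms, of A] by simp
next
  case (3 n A)
  have "0 \<le> real n * lval M e A s" "0 \<le> lval M e A s"
    using lval_bounds[OF Le assms, of A] by simp_all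
  then show ?case
    using 3 by (simp add: lval_connectives[OF assms] distrib_right)
qed

text \<open>
  The counterpart of \<open>excision_form_nonpos_iff\<close>, with thresholds \<open>2/3\<close> and \<open>1/3\<close> for \<open>A\<close>. A
  formula without atomic subformulas imposes no lower bound, by the convention on \<open>LMult 0\<close>.
\<close>

lemma lsat_excision_sentence_iff:
  assumes xz: "x \<noteq> z" and z: "z \<notin> lfv A"
  shows "lsat M e (excision_sentence A x z ys) \<longleftrightarrow>
    (\<forall>s. assignment s \<longrightarrow> (\<forall>\<delta>>0. \<exists>c\<in>M. \<forall>a\<in>M.
      (2 + \<delta> < 3 * lval M e A (s(x := a)) \<longrightarrow> e a c \<le> \<delta>) \<and>
      (0 < occ A \<longrightarrow> 3 * lval M e A (s(x := a)) < 1 - \<delta> \<longrightarrow> 1 - \<delta> \<le> 6 * real (occ A) * e a c)))"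
proof -
  let ?B = "LAnd (LOr (LIn x z) (LNot A \<oplus>l LNot A \<oplus>l LNot A))
             (LOr (LMult (6 * occ A) (LNot (LIn x z))) (A \<oplus>l A \<oplus>l A))"
  let ?P = "\<lambda>s \<delta> c a. (2 + \<delta> < 3 * lval M e A (s(x := a)) \<longrightarrow> e a c \<le> \<delta>) \<and>
      (0 < occ A \<longrightarrow> 3 * lval M e A (s(x := a)) < 1 - \<delta> \<longrightarrow> 1 - \<delta> \<le> 6 * real (occ A) * e a c)"
  have B: "1 - \<delta> \<le> lval M e ?B (s(z := c, x := a)) \<longleftrightarrow>
      ?P s \<delta> c a"
    if s: "assignment s" and c: "c \<in> M" and a: "a \<in> M" and \<delta>: "0 < \<delta>" for s c a and \<delta> :: real
  proof -
    have t: "assignment (s(z := c, x := a))"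
      by (intro assignment_upd s c a)
    have eq: "lval M e A (s(z := c, x := a)) = lval M e A (s(x := a))"
      using z by (intro lval_cong) auto
    define g where "g = lval M e A (s(x := a))"
    have g: "0 \<le> g \<and> g \<le> 1"
      unfolding g_def by (rule lval_bounds[OF Le assignment_upd[OF s a]])
    have left: "lval M e (LOr (LIn x z) (LNot A \<oplus>l LNot A \<oplus>l LNot A)) (s(z := c, x := a)) =
        max (1 - e a c) (min (1 - g + min (1 - g + (1 - g)) 1) 1)"
      unfolding lval_connectives[OF t] eq g_def[symmetric] using xz by simp
    have right: "lval M e (LOr (LMult (6 * occ A) (LNot (LIn x z))) (A \<oplus>l A \<oplus>l A))
          (s(z := c, x := a)) =
        max (if occ A = 0 then 1 else min (6 * real (occ A) * e a c) 1) (min (g + min (g + g) 1) 1)"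
      unfolding lval_connectives[OF t] lval_LMult[OF t] eq g_def[symmetric] using xz by simp
    have "1 - \<delta> \<le> lval M e ?B (s(z := c, x := a)) \<longleftrightarrow>
        1 - \<delta> \<le> lval M e (LOr (LIn x z) (LNot A \<oplus>l LNot A \<oplus>l LNot A)) (s(z := c, x := a)) \<and>
        1 - \<delta> \<le> lval M e (LOr (LMult (6 * occ A) (LNot (LIn x z))) (A \<oplus>l A \<oplus>l A))
          (s(z := c, x := a))"
      unfolding lval_connectives(3)[OF t] by (rule min.bounded_iff)
    also have "\<dots> \<longleftrightarrow> ?P s \<delta> c a"
    proof (rule arg_cong2[where f = "(\<and>)"])
      show "1 - \<delta> \<le> lval M e (LOr (LIn x z) (LNot A \<oplus>l LNot A \<oplus>l LNot A)) (s(z := c, x := a))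
          \<longleftrightarrow> (2 + \<delta> < 3 * lval M e A (s(x := a)) \<longrightarrow> e a c \<le> \<delta>)"
        using g \<delta>
        unfolding left g_def[symmetric] le_max_iff_disj min.bounded_iff min_add_distrib_right
        by auto
      show "1 - \<delta> \<le> lval M e (LOr (LMult (6 * occ A) (LNot (LIn x z))) (A \<oplus>l A \<oplus>l A))
            (s(z := c, x := a)) \<longleftrightarrow>
          (0 < occ A \<longrightarrow> 3 * lval M e A (s(x := a)) < 1 - \<delta> \<longrightarrow>
            1 - \<delta> \<le> 6 * real (occ A) * e a c)"
        using g \<delta>
        unfolding right g_def[symmetric] le_max_iff_disj min.bounded_iff min_add_distrib_right
        by auto
    qed
    finally show ?thesis .
  qed
  have "lval M e (LEx z (LAll x ?B)) s = 1 \<longleftrightarrow> (\<forall>\<delta>>0. \<exists>c\<in>M. \<forall>a\<in>M.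
      ?P s \<delta> c a)"
    if s: "assignment s" for s
  proof -
    have "lval M e (LEx z (LAll x ?B)) s = 1 \<longleftrightarrow> 1 \<le> lval M e (LEx z (LAll x ?B)) s"
      using lval_bounds[OF Le s, of "LEx z (LAll x ?B)"] by linarith
    also have "\<dots> \<longleftrightarrow> (\<forall>\<delta>>0. \<exists>c\<in>M. \<forall>a\<in>M. ?P s \<delta> c a)"
      unfolding lval.simps(4)
    proof (rule le_SUP_iff_approx[OF M_nonempty lval_bdd(1)[OF s]])
      fix c and \<delta> :: real assume c: "c \<in> M" and \<delta>: "0 < \<delta>"
      have "1 - \<delta> \<le> lval M e (LAll x ?B) (s(z := c)) \<longleftrightarrow>
          (\<forall>a\<in>M. 1 - \<delta> \<le> lval M e ?B (s(z := c, x := a)))"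
        unfolding lval.simps(5)
        by (rule le_cINF_iff[OF M_nonempty lval_bdd(2)[OF assignment_upd[OF s c]]])
      also have "\<dots> \<longleftrightarrow> (\<forall>a\<in>M. ?P s \<delta> c a)"
        by (rule ball_cong[OF refl B[OF s c _ \<delta>]])
      finally show "1 - \<delta> \<le> lval M e (LAll x ?B) (s(z := c)) \<longleftrightarrow> (\<forall>a\<in>M. ?P s \<delta> c a)" .
    qed
    finally show ?thesis .
  qed
  then show ?thesis
    unfolding excision_sentence_def lsat_foldr_LAll unfolding lsat_def by (rule all_cong)
qed

section \<open>From excision to the sentences\<close>

primrec to_rform :: "lform \<Rightarrow> rform" where
  "to_rform (LIn x y) = RAdd ROne (RScale (-1) (RE x y))"
| "to_rform LBot = RScale 0 ROne"
| "to_rform (LImp A B) = RMin (RAdd (RAdd ROne (RScale (-1) (to_rform A))) (to_rform B)) ROne"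
| "to_rform (LEx x A) = RSup x (to_rform A)"
| "to_rform (LAll x A) = RInf x (to_rform A)"

lemma rval_to_rform: "rval M e (to_rform A) s = lval M e A s"
  by (induction A arbitrary: s) simp_all

lemma rfv_to_rform: "rfv (to_rform A) = lfv A"
  by (induction A) auto

lemma eps_pos: "0 < eps p"
  by (simp add: eps_def)

lemma lsat_excision_sentence:
  assumes H: "H_extensional M e" and E: "excision M e"
    and dist: "distinct (x # z # ys)" and fv: "lfv A \<subseteq> insert x (set ys)"
  shows "lsat M e (excision_sentence A x z ys)"
proof -
  have xz: "x \<noteq> z" and z: "z \<notin> lfv A" using dist fv by auto
  show ?thesis
    unfolding lsat_excision_sentence_iff[OF xz z]
  proof (intro allI impI)
    fix s and \<delta> :: real assume s: "assignment s" and \<delta>: "0 < \<delta>"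
    let ?g = "\<lambda>a. lval M e A (s(x := a))"
    obtain n :: nat where n: "6 / \<delta> \<le> real n" using real_arch_simple by blast
    have "0 < 6 / \<delta>" using \<delta> by simp
    then have n0: "0 < real n" using n by linarith
    have n\<delta>: "2 / real n \<le> \<delta> / 3" using n n0 \<delta> by (simp add: field_simps)
    \<comment> \<open>the thresholds \<open>0\<close> and \<open>1\<close> for \<open>p\<close> become \<open>2/3\<close> and \<open>2/3 - 1/n\<close> for \<open>A\<close>; the choice of \<open>n\<close>
      makes twice the gap at most \<open>\<delta>/3\<close>, which is the slack in \<open>3 * A < 1 - \<delta>\<close>\<close>
    define p where "p = RAdd (RScale (2 * of_nat n / 3) ROne) (RScale (- of_nat n) (to_rform A))"
    have p: "rval M e p t = real n * (2 / 3 - lval M e A t)" for t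
      by (simp add: p_def rval_to_rform of_rat_divide of_rat_mult of_rat_minus algebra_simps)
    have pfv: "rfv p = lfv A" by (simp add: p_def rfv_to_rform)
    define \<epsilon> where "\<epsilon> = real_of_rat (eps p)"
    have \<epsilon>: "0 < \<epsilon>" using eps_pos by (simp add: \<epsilon>_def)
    define \<delta>' where "\<delta>' = min \<delta> (min 1 (\<epsilon> / 2))"
    have \<delta>': "0 < \<delta>'" "\<delta>' \<le> \<delta>" "\<delta>' \<le> 1" "\<delta>' \<le> \<epsilon> / 2" using \<delta> \<epsilon> by (auto simp: \<delta>'_def)
    have "\<forall>s. assignment s \<longrightarrow> rval M e (excision_form p x z ys) s \<le> 0"
      using E[unfolded excision_def, rule_format, OF dist fv[folded pfv]] by blast
    moreover have "z \<notin> rfv p" using z by (simp add: pfv)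
    ultimately have "\<exists>c\<in>M. \<forall>a\<in>M. (rval M e p (s(x := a)) < - \<delta>' \<longrightarrow> e a c \<le> \<delta>') \<and>
        (1 + \<delta>' < rval M e p (s(x := a)) \<longrightarrow> \<epsilon> - \<delta>' \<le> e a c)"
      unfolding \<epsilon>_def
      by (intro excision_form_nonpos_iff[OF xz, THEN iffD1, rule_format, OF _ _ s \<delta>'(1)]) blast+
    then obtain c where c: "c \<in> M"
      and low: "\<And>a. a \<in> M \<Longrightarrow> real n * (2 / 3 - ?g a) < - \<delta>' \<Longrightarrow> e a c \<le> \<delta>'"
      and high: "\<And>a. a \<in> M \<Longrightarrow> 1 + \<delta>' < real n * (2 / 3 - ?g a) \<Longrightarrow> \<epsilon> - \<delta>' \<le> e a c"
      unfolding p by blast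
    have "e a c \<le> \<delta>" if a: "a \<in> M" and g: "2 + \<delta> < 3 * ?g a" for a
    proof -
      have "2 / 3 - ?g a < - (2 / real n)" using g n\<delta> by linarith
      then have "real n * (2 / 3 - ?g a) < real n * (- (2 / real n))"
        using n0 by (intro mult_strict_left_mono)
      then have "real n * (2 / 3 - ?g a) < - \<delta>'" using n0 \<delta>'(3) by simp
      from low[OF a this] show ?thesis using \<delta>'(2) by linarith
    qed
    moreover have "1 - \<delta> \<le> 6 * real (occ A) * e a c"
      if a: "a \<in> M" and occ: "0 < occ A" and g: "3 * ?g a < 1 - \<delta>" for a
    proof -
      let ?K = "2 * real (occ A)"
      \<comment> \<open>positive where \<open>A\<close> is clear of the thresholds, and more than \<open>1 / (3 * ?K)\<close> where
        \<open>3 * A < 1 - \<delta>\<close>; dividing by the Lipschitz constant makes it \<open>1\<close>-Lipschitz\<close>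
      define T where "T = (\<lambda>a. (2 / 3 - 2 / real n - ?g a) / ?K)"
      have K: "1 \<le> ?K" "0 < ?K" using occ by linarith+
      have "T a \<le> e a c"
      proof (rule extensional_lower_bound[OF H c a])
        fix b assume b: "b \<in> M"
        have "2 / 3 - 2 / real n - ?g b \<le> 1 * ?K"
          using lval_bounds[OF Le assignment_upd[OF s b], of A x] K(1) divide_pos_pos[of 2 "real n"] n0
          by linarith
        then show "T b \<le> 1" unfolding T_def using K(2) by (simp add: pos_divide_le_eq)
      next
        fix b b' assume b: "b \<in> M" "b' \<in> M"
        have "\<bar>?g b - ?g b'\<bar> \<le> ?K * dd b b'"
          by (rule lval_lipschitz[OF H]) (intro assignment_upd s b dd_fun_upd)+
        then have "?g b' - ?g b \<le> dd b b' * ?K" by (simp add: mult.commute)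
        then have "(?g b' - ?g b) / ?K \<le> dd b b'" using K(2) by (simp add: pos_divide_le_eq)
        then show "T b - T b' \<le> dd b b'" by (simp add: T_def diff_divide_distrib)
      next
        show "0 < \<epsilon> / 2" using \<epsilon> by simp
        fix b assume b: "b \<in> M" "0 < T b"
        then have "2 / real n < 2 / 3 - ?g b"
          using K(2) by (simp add: T_def zero_less_divide_iff)
        then have "2 < real n * (2 / 3 - ?g b)" using n0 by (simp add: pos_divide_less_eq mult.commute)
        then have "1 + \<delta>' < real n * (2 / 3 - ?g b)" using \<delta>'(3) by linarith
        from high[OF b(1) this] show "\<epsilon> / 2 \<le> e b c" using \<delta>'(4) by linarith
      qed
      then have "2 / 3 - 2 / real n - ?g a \<le> e a c * ?K"
        unfolding T_def using K(2) by (simp add: pos_divide_le_eq)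
      moreover have "1 / 3 < 2 / 3 - 2 / real n - ?g a" using g n\<delta> by linarith
      ultimately have "1 \<le> 3 * (e a c * ?K)" by linarith
      then show ?thesis using \<delta> by (simp add: mult.commute mult.left_commute)
    qed
    ultimately show "\<exists>c\<in>M. \<forall>a\<in>M. (2 + \<delta> < 3 * ?g a \<longrightarrow> e a c \<le> \<delta>) \<and>
        (0 < occ A \<longrightarrow> 3 * ?g a < 1 - \<delta> \<longrightarrow> 1 - \<delta> \<le> 6 * real (occ A) * e a c)"
      using c by blast
  qed
qed

section \<open>From the sentences to excision\<close>

text \<open>
  The excision sentence is applied to a formula defining a steep truncation of \<open>- p\<close>. Its constant
  depends on the size of that formula, hence on \<open>\<delta>\<close>, but self-improvement replaces it by
  \<open>1 / (2 * v_of p)\<close>.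
\<close>

lemma excision_form_nonpos:
  assumes H: "H_extensional M e"
    and S: "\<And>A. lfv A \<subseteq> insert x (set ys) \<Longrightarrow> lsat M e (excision_sentence A x z ys)"
    and dist: "distinct (x # z # ys)" and fv: "rfv p \<subseteq> insert x (set ys)"
  shows "\<forall>s. assignment s \<longrightarrow> rval M e (excision_form p x z ys) s \<le> 0"
proof -
  have xz: "x \<noteq> z" and z: "z \<notin> rfv p" using dist fv by auto
  show ?thesis
    unfolding excision_form_nonpos_iff[OF xz z]
  proof (intro allI impI)
    fix s and \<delta> :: real assume s: "assignment s" and \<delta>: "0 < \<delta>"
    let ?f = "\<lambda>a. rval M e p (s(x := a))"
    obtain N :: int where N: "1 \<le> N"
      and def: "\<And>k. definable (rfv p) (\<lambda>s. of_int (k * N) * rval M e p s)"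
      using definable_rval_multiple[of p] by blast
    \<comment> \<open>steep enough for the truncation of \<open>- k * N * p\<close> to reach \<open>1\<close> already at \<open>p = - \<delta>\<close>\<close>
    obtain k :: nat where k: "1 / \<delta> \<le> real k" using real_arch_simple by blast
    obtain A where A: "lfv A \<subseteq> rfv p"
      "\<And>s. assignment s \<Longrightarrow> lval M e A s = clamp (of_int (- int k * N) * rval M e p s + of_int 0)"
      using def[of "- int k"] unfolding definable_def by blast
    \<comment> \<open>\<open>B\<close> has the value of \<open>A\<close>, but it contains an atomic formula even if \<open>A\<close> does not; without
      one, the second half of the excision sentence would be void\<close>
    define B where "B = LImp (LImp LBot (LIn x x)) A"
    have occ: "1 \<le> real (occ B)" by (simp add: B_def)
    have Bfv: "lfv B \<subseteq> insert x (set ys)" using A(1) fv by (auto simp: B_def)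
    then have zB: "z \<notin> lfv B" using dist by auto
    have B: "lval M e B (s(x := a)) = clamp (- (real k * of_int N * ?f a))" if a: "a \<in> M" for a
      using A(2)[OF assignment_upd[OF s a]] e_bounds[OF a a]
      by (simp add: B_def clamp_def)
    define \<delta>' where "\<delta>' = min \<delta> (1 / 2)"
    have \<delta>': "0 < \<delta>'" "\<delta>' \<le> \<delta>" "\<delta>' \<le> 1 / 2" using \<delta> by (auto simp: \<delta>'_def)
    obtain c where c: "c \<in> M"
      and low: "\<And>a. a \<in> M \<Longrightarrow> 2 + \<delta>' < 3 * lval M e B (s(x := a)) \<Longrightarrow> e a c \<le> \<delta>'"
      and high: "\<And>a. a \<in> M \<Longrightarrow> 3 * lval M e B (s(x := a)) < 1 - \<delta>' \<Longrightarrow>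
        1 - \<delta>' \<le> 6 * real (occ B) * e a c"
      using S[OF Bfv, unfolded lsat_excision_sentence_iff[OF xz zB], rule_format, OF s \<delta>'(1)] occ
      by auto
    have "e a c \<le> \<delta>" if a: "a \<in> M" and f: "?f a < - \<delta>" for a
    proof -
      have "1 \<le> real k * \<delta>" using k \<delta> by (simp add: pos_divide_le_eq)
      also have "\<dots> \<le> real k * of_int N * \<delta>"
        using N \<delta> mult_left_mono[of 1 "of_int N" "real k * \<delta>"] by (simp add: mult.commute mult.left_commute)
      also have "\<dots> \<le> real k * of_int N * (- ?f a)"
        using N f by (intro mult_left_mono) auto
      finally have "lval M e B (s(x := a)) = 1" unfolding B[OF a] by (simp add: clamp_def)
      with low[OF a] \<delta>' show ?thesis by linarith
    qed
    moreover have "of_rat (eps p) - \<delta> \<le> e a c" if a: "a \<in> M" and f: "1 + \<delta> < ?f a" for a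
    proof -
      let ?v = "real_of_rat (v_of p)"
      \<comment> \<open>\<open>v_of p\<close> bounds \<open>p\<close>, so the upper threshold is exceeded only if \<open>v_of p\<close> exceeds \<open>1\<close>\<close>
      have v: "1 < ?v" using abs_rval_le[OF assignment_upd[OF s a], of p x] f \<delta> by linarith
      define T where "T = (\<lambda>a. ?f a / (2 * ?v))"
      have "T a \<le> e a c"
      proof (rule extensional_lower_bound[OF H c a])
        fix b assume b: "b \<in> M"
        have "?f b \<le> 1 * (2 * ?v)"
          using abs_rval_le[OF assignment_upd[OF s b], of p x] v by linarith
        then show "T b \<le> 1" unfolding T_def using v by (simp add: pos_divide_le_eq)
      next
        fix b b' assume b: "b \<in> M" "b' \<in> M"
        have "\<bar>?f b - ?f b'\<bar> \<le> ?v * (2 * dd b b')"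
          by (rule rval_lipschitz[OF H]) (intro assignment_upd s b dd_fun_upd)+
        then have "?f b - ?f b' \<le> dd b b' * (2 * ?v)" by (simp add: mult.commute mult.left_commute)
        then have "(?f b - ?f b') / (2 * ?v) \<le> dd b b'" using v by (simp add: pos_divide_le_eq)
        then show "T b - T b' \<le> dd b b'" by (simp add: T_def diff_divide_distrib)
      next
        show "0 < 1 / (12 * real (occ B))" using occ by simp
        fix b assume b: "b \<in> M" "0 < T b"
        then have "0 < ?f b" using v by (simp add: T_def zero_less_divide_iff)
        then have "0 \<le> real k * of_int N * ?f b" using N by (intro mult_nonneg_nonneg) auto
        then have "lval M e B (s(x := b)) = 0" unfolding B[OF b(1)] by (simp add: clamp_def)
        with high[OF b(1)] \<delta>' have "1 / 2 \<le> 6 * real (occ B) * e b c" by linarith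
        then have "1 \<le> e b c * (12 * real (occ B))" by (simp add: mult.commute mult.left_commute)
        then show "1 / (12 * real (occ B)) \<le> e b c" using occ by (simp add: pos_divide_le_eq)
      qed
      moreover have "1 / (2 * ?v) \<le> T a" unfolding T_def using f \<delta> v by (intro divide_right_mono) auto
      moreover have "of_rat (eps p) \<le> 1 / (2 * ?v)"
      proof -
        have "real_of_rat (eps p) = 1 / max (6 * ?v) 3"
          by (simp add: eps_def of_rat_divide of_rat_max of_rat_mult)
        also have "\<dots> \<le> 1 / (2 * ?v)" using v by (intro divide_left_mono) auto
        finally show ?thesis .
      qed
      ultimately show ?thesis using \<delta> by linarith
    qed
    ultimately show "\<exists>c\<in>M. \<forall>a\<in>M. (?f a < - \<delta> \<longrightarrow> e a c \<le> \<delta>) \<and>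
        (1 + \<delta> < ?f a \<longrightarrow> of_rat (eps p) - \<delta> \<le> e a c)"
      using c by blast
  qed
qed

end

theorem proposition7p1:
  fixes M :: "'a set" and e :: "'a \<Rightarrow> 'a \<Rightarrow> real"
  assumes "Le_structure M e"
  shows "H_extensional M e \<and> excision M e \<longleftrightarrow>
    lsat M e H_ext_sentence \<and>
    (\<forall>A x z ys. distinct (x # z # ys) \<longrightarrow> lfv A \<subseteq> insert x (set ys) \<longrightarrow>
       lsat M e (excision_sentence A x z ys))"
proof -
  interpret Le_model M e by unfold_locales (rule assms)
  show ?thesis
    unfolding lsat_H_ext_sentence
  proof (rule conj_cong[OF refl], rule iffI)
    assume "H_extensional M e" "excision M e"
    then show "\<forall>A x z ys. distinct (x # z # ys) \<longrightarrow> lfv A \<subseteq> insert x (set ys) \<longrightarrow>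
       lsat M e (excision_sentence A x z ys)"
      using lsat_excision_sentence by blast
  next
    assume H: "H_extensional M e" and S: "\<forall>A x z ys. distinct (x # z # ys) \<longrightarrow>
       lfv A \<subseteq> insert x (set ys) \<longrightarrow> lsat M e (excision_sentence A x z ys)"
    show "excision M e"
      unfolding excision_def
    proof (intro allI impI)
      fix p x z ys and s :: "nat \<Rightarrow> 'a"
      assume dist: "distinct (x # z # ys)" and fv: "rfv p \<subseteq> insert x (set ys)"
        and s: "assignment s"
      have "lsat M e (excision_sentence A x z ys)" if "lfv A \<subseteq> insert x (set ys)" for A
        using S dist that by blast
      from excision_form_nonpos[OF H this dist fv] s
      show "rval M e (excision_form p x z ys) s \<le> 0" by blast
    qed
  qed
qed

end
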